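(* There exist absolute constants $C_1,C_2>0$ with the following property. Let $\Omega\subset\mathbb{R}^d$ be compact, let $\mu$ be a probability measure on $\Omega$, and let $X_N$ be an $N$-dimensional subspace of real-valued continuous functions on $\Omega$ (also $N$-dimensional in $L_2(\Omega,\mu)$) which contains the constant function $1$. Then for every nonnegative integer $M$ there exists a set of $m$ points $\xi^1,\dots,\xi^m\in\Omega$ with $m\le C_1(M+N)N\log((M+N)N)$ such that for every $f\in X_N$ $$ \|f\|_\infty\le C_2\,\sigma_M^c(\mathcal{D}(X_N))_{(\infty,1)}\,\max_{1\le \nu\le m}|f(\xi^\nu)|. $$
   Context: $\|f\|_\infty=\max_{\mathbf x\in\Omega}|f(\mathbf x)|$, and $\|\cdot\|_1$ denotes the norm of $L_1(\Omega,\mu)$. Dirichlet kernel: if $\{u_j\}_{j=1}^N$ is an orthonormal basis of $X_N$ in $L_2(\Omega,\mu)$, then $\mathcal{D}(X_N)(\mathbf x,\mathbf y)=\mathcal D(X_N,\mathbf x,\mathbf y):=\sum_{j=1}^N u_j(\mathbf x)u_j(\mathbf y)$ (independent of the choice of orthonormal basis). Let $\mathcal{B}_M(X_N^\perp)$ be the set of all functions $\mathcal{W}(\mathbf x,\mathbf y)=\sum_{i=1}^M w_i(\mathbf x)v_i(\mathbf y)$ with $w_i\in\mathcal C(\Omega)$ (real continuous) and $v_i\in L_1(\Omega,\mu)$, $i=1,\dots,M$, such that for every $f\in X_N$ and every $\mathbf x\in\Omega$ one has $\int_\Omega\mathcal W(\mathbf x,\mathbf y)f(\mathbf y)\,d\mu(\mathbf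 y)=0$ (for $M=0$, $\mathcal B_0(X_N^\perp)=\{0\}$). For a continuous function $\mathcal K$ on $\Omega\times\Omega$, $$\sigma_M^c(\mathcal K)_{(\infty,1)}:=\inf_{\mathcal W\in\mathcal B_M(X_N^\perp)}\sup_{\mathbf x\in\Omega}\|\mathcal K(\mathbf x,\cdot)-\mathcal W(\mathbf x,\cdot)\|_1.$$
   Formalization: The logarithm log((M+N)N) is read as log(max(2,(M+N)N)): for N=1, M=0 the literal bound forces m ≤ 0, so no point could be chosen and the inequality fails for f=1; all other cases are unchanged. *)

theory Defs
  imports "HOL-Probability.Probability"
begin

text \<open>Points of R^d are encoded as vectors nat => real vanishing from index d on;
  the product topology on nat => real restricted to this set is the Euclidean one.\<close>

definition euclid_pts :: "nat \<Rightarrow> (nat \<Rightarrow> real) set" where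
  "euclid_pts d = {x. \<forall>i\<ge>d. x i = 0}"

definition fspan :: "nat \<Rightarrow> (nat \<Rightarrow> 'a \<Rightarrow> real) \<Rightarrow> ('a \<Rightarrow> real) set" where
  "fspan N u = {(\<lambda>x. \<Sum>i<N. c i * u i x) | c. True}"

definition cont_subspace_dim :: "'a::topological_space measure \<Rightarrow> 'a set \<Rightarrow> nat \<Rightarrow> ('a \<Rightarrow> real) set \<Rightarrow> bool" where
  "cont_subspace_dim \<mu> \<Omega> N X \<longleftrightarrow>
     (\<exists>u. X = fspan N u \<and> (\<forall>i<N. continuous_on \<Omega> (u i)) \<and>
          (\<forall>c. (AE x in \<mu>. (\<Sum>i<N. c i * u i x) = 0) \<longrightarrow> (\<forall>i<N. c i = 0)))"

definition is_onb :: "'a measure \<Rightarrow> nat \<Rightarrow> ('a \<Rightarrow> real) set \<Rightarrow> (nat \<Rightarrow> 'a \<Rightarrow> real) \<Rightarrow> bool" where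
  "is_onb \<mu> N X u \<longleftrightarrow> (\<forall>i<N. u i \<in> X) \<and>
     (\<forall>i<N. \<forall>j<N. integrable \<mu> (\<lambda>x. u i x * u j x) \<and>
        (LINT x|\<mu>. u i x * u j x) = (if i = j then 1 else 0))"

definition dirichlet_kernel :: "'a measure \<Rightarrow> nat \<Rightarrow> ('a \<Rightarrow> real) set \<Rightarrow> 'a \<Rightarrow> 'a \<Rightarrow> real" where
  "dirichlet_kernel \<mu> N X = (let u = (SOME u. is_onb \<mu> N X u) in (\<lambda>x y. \<Sum>j<N. u j x * u j y))"

definition B_perp :: "'a::topological_space measure \<Rightarrow> 'a set \<Rightarrow> ('a \<Rightarrow> real) set \<Rightarrow> nat \<Rightarrow> ('a \<Rightarrow> 'a \<Rightarrow> real) set" where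
  "B_perp \<mu> \<Omega> X M = {W. \<exists>w v.
      (\<forall>i<M. continuous_on \<Omega> (w i) \<and> integrable \<mu> (v i)) \<and>
      (\<forall>x y. W x y = (\<Sum>i<M. w i x * v i y)) \<and>
      (\<forall>f\<in>X. \<forall>x\<in>\<Omega>. (LINT y|\<mu>. W x y * f y) = 0)}"

definition sigma_c :: "'a::topological_space measure \<Rightarrow> 'a set \<Rightarrow> ('a \<Rightarrow> real) set \<Rightarrow> nat \<Rightarrow> ('a \<Rightarrow> 'a \<Rightarrow> real) \<Rightarrow> real" where
  "sigma_c \<mu> \<Omega> X M K =
     Inf {Sup ((\<lambda>x. LINT y|\<mu>. \<bar>K x y - W x y\<bar>) ` \<Omega>) | W. W \<in> B_perp \<mu> \<Omega> X M}"

end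

theory Submission
  imports Defs
begin

text \<open>Let \<open>W\<close> be a nearly optimal approximation of the Dirichlet kernel \<open>D\<close>, so that
  \<open>f(x) = \<integral> (D - W)(x,y) f(y) d\<mu>(y)\<close> for \<open>f\<close> in \<open>X\<close>. The functions \<open>(D - W)(x,\<cdot>)\<close> lie in a
  space \<open>Y\<close> of dimension \<open>M + N\<close>, and the products \<open>g f\<close> with \<open>g\<close> in \<open>Y\<close> and \<open>f\<close> in \<open>X\<close> span a
  space \<open>Z\<close> of dimension at most \<open>n = (M + N) N\<close>, which contains \<open>Y\<close> because \<open>X\<close> contains \<open>1\<close>.
  If a weighted sum over \<open>m\<close> points is comparable to the \<open>L\<^sub>1\<close> norm on all of \<open>Z\<close>, then
  \<open>|f(x)| \<le> \<parallel>(D - W)(x,\<cdot>) f\<parallel>\<^sub>1\<close> is at most a constant times the maximum of \<open>|f|\<close> over the points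
  times the weighted sum of \<open>|(D - W)(x,\<cdot>)|\<close>, hence at most a constant times that maximum times
  \<open>\<parallel>(D - W)(x,\<cdot>)\<parallel>\<^sub>1\<close>.

  Such points with \<open>m\<close> of order \<open>n log n\<close> come from random sampling of \<open>Z\<close>: after a change of density
  (Lewis weights) \<open>Z\<close> has a reproducing kernel \<open>K\<close> bounded by a multiple of \<open>n\<close>; symmetrization and
  the contraction principle remove the absolute values, and the resulting Rademacher sum is
  \<open>\<integral> h(y) F(y) dy\<close> with \<open>F(y)\<close> a signed sum of the \<open>K(x\<^sub>k,y)\<close>, whose exponential moments are
  controlled for each single \<open>y\<close>. Since \<open>|h|\<close> is at most \<open>O(n)\<close> when \<open>\<parallel>h\<parallel>\<^sub>1 \<le> 1\<close>, Young's inequality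
  between \<open>h\<close> and \<open>exp F\<close> costs only a factor \<open>log n\<close>, and no union bound over \<open>y\<close> is needed.\<close>

section \<open>Random sampling with a reproducing kernel\<close>

text \<open>Expectation of \<open>F\<close> over \<open>k\<close> independent draws from the weights
  \<open>p\<close>. The iterated finite sum stands in for a product measure, so that induction peels
  off the first draw and no question of measurability arises.\<close>

fun list_mean :: "('b \<Rightarrow> real) \<Rightarrow> 'b set \<Rightarrow> nat \<Rightarrow> ('b list \<Rightarrow> real) \<Rightarrow> real" where
  "list_mean p S 0 F = F []"
| "list_mean p S (Suc k) F = (\<Sum>x\<in>S. p x * list_mean p S k (\<lambda>xs. F (x # xs)))"

lemma list_mean_mono:
  assumes "\<And>x. x \<in> S \<Longrightarrow> 0 \<le> p x"
    and "\<And>xs. set xs \<subseteq> S \<Longrightarrow> length xs = k \<Longrightarrow> F xs \<le> G xs"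
  shows "list_mean p S k F \<le> list_mean p S k G"
  using assms(2)
proof (induction k arbitrary: F G)
  case 0
  then show ?case by simp
next
  case (Suc k)
  show ?case
    unfolding list_mean.simps
    by (intro sum_mono mult_left_mono Suc.IH assms(1) Suc.prems) auto
qed

lemma list_mean_add:
  "list_mean p S k (\<lambda>xs. F xs + G xs) = list_mean p S k F + list_mean p S k G"
  by (induction k arbitrary: F G) (simp_all add: distrib_left sum.distrib)

lemma list_mean_cmult:
  "list_mean p S k (\<lambda>xs. c * F xs) = c * list_mean p S k F"
  by (induction k arbitrary: F) (simp_all add: sum_distrib_left mult.left_commute)

lemma list_mean_sum:
  "list_mean p S k (\<lambda>xs. \<Sum>i\<in>I. F i xs) = (\<Sum>i\<in>I. list_mean p S k (F i))"
proof (induction k arbitrary: F)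
  case 0
  show ?case by simp
next
  case (Suc k)
  show ?case
    by (simp add: Suc.IH sum_distrib_left, rule sum.swap)
qed

lemma list_mean_const:
  assumes "sum p S = 1"
  shows "list_mean p S k (\<lambda>xs. c) = c"
  using assms by (induction k) (simp_all flip: sum_distrib_right)

lemma list_mean_prod_list:
  "list_mean p S k (\<lambda>xs. prod_list (map f xs)) = (\<Sum>x\<in>S. p x * f x) ^ k"
  by (induction k) (simp_all add: list_mean_cmult sum_distrib_right mult.assoc)

text \<open>The probabilistic method: if every first draw had conditional mean above
  \<open>c\<close>, the overall mean would exceed \<open>c\<close>, because some weight is positive.
  So a good first entry can be fixed, and the rest follows by induction.\<close>

lemma list_mean_le_imp_ex:
  assumes "finite S" "\<And>x. x \<in> S \<Longrightarrow> 0 \<le> p x" "sum p S = 1"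
    and "list_mean p S k F \<le> c"
  shows "\<exists>xs. set xs \<subseteq> S \<and> length xs = k \<and> F xs \<le> c"
  using assms(4)
proof (induction k arbitrary: F)
  case 0
  then show ?case by simp
next
  case (Suc k)
  let ?M = "\<lambda>x. list_mean p S k (\<lambda>xs. F (x # xs))"
  have "\<exists>x\<in>S. ?M x \<le> c"
  proof (rule ccontr)
    assume "\<not> ?thesis"
    then have gt: "\<And>x. x \<in> S \<Longrightarrow> c < ?M x" by force
    have "\<exists>x\<in>S. p x \<noteq> 0"
      using assms(3) by (metis sum.neutral zero_neq_one)
    then obtain x where x: "x \<in> S" "p x > 0"
      using assms(2) by force
    have "(\<Sum>x\<in>S. p x * c) < (\<Sum>x\<in>S. p x * ?M x)"
    proof (rule sum_strict_mono_ex1[OF assms(1)])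
      show "\<forall>x\<in>S. p x * c \<le> p x * ?M x"
        using gt by (intro ballI mult_left_mono assms(2)) (auto intro: less_imp_le)
      show "\<exists>x\<in>S. p x * c < p x * ?M x"
        using x gt by (auto intro!: bexI[of _ x])
    qed
    moreover have "(\<Sum>x\<in>S. p x * c) = c"
      using assms(3) by (simp flip: sum_distrib_right)
    ultimately show False
      using Suc.prems by simp
  qed
  then obtain x where "x \<in> S" "?M x \<le> c" by blast
  with Suc.IH[of "\<lambda>xs. F (x # xs)"] obtain xs
    where "set xs \<subseteq> S" "length xs = k" "F (x # xs) \<le> c" by blast
  with \<open>x \<in> S\<close> show ?case
    by (intro exI[of _ "x # xs"]) auto
qed

text \<open>In each coordinate, \<open>|t x|\<close> is compared with an independent copy; averaging the two
  suprema \<open>U\<close>, \<open>V\<close> taken with opposite signs symmetrizes, and \<open>||s| - |t|| \<le> |s - t|\<close> removes the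
  absolute values from their sum.\<close>

lemma symmetrization_contraction_step:
  fixes T :: "('b \<Rightarrow> real) set"
  assumes S: "finite S" "\<And>x. x \<in> S \<Longrightarrow> 0 \<le> p x" "sum p S = 1"
    and T: "T \<noteq> {}" "\<And>t x. t \<in> T \<Longrightarrow> x \<in> S \<Longrightarrow> \<bar>t x\<bar> \<le> D"
    and a: "\<And>t. t \<in> T \<Longrightarrow> a t \<le> A"
    and \<sigma>: "\<sigma> = 1 \<or> \<sigma> = - 1"
  shows "(\<Sum>x\<in>S. p x * (SUP t\<in>T. a t + \<sigma> * ((\<Sum>y\<in>S. p y * \<bar>t y\<bar>) - \<bar>t x\<bar>)))
    \<le> (\<Sum>x\<in>S. p x * (((SUP t\<in>T. a t + 2 * t x) + (SUP t\<in>T. a t - 2 * t x)) / 2))"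
proof -
  define U where "U x = (SUP t\<in>T. a t + 2 * \<bar>t x\<bar>)" for x
  define V where "V x = (SUP t\<in>T. a t - 2 * \<bar>t x\<bar>)" for x
  \<comment> \<open>A real supremum is informative only over a set bounded above, so the families
    are bounded first.\<close>
  have bdd: "bdd_above ((\<lambda>t. a t + e * \<bar>t x\<bar>) ` T)" "bdd_above ((\<lambda>t. a t + e * t x) ` T)"
    if "x \<in> S" for x e
  proof -
    have le: "e * \<bar>t x\<bar> \<le> \<bar>e\<bar> * D" "e * t x \<le> \<bar>e\<bar> * D" if "t \<in> T" for t
    proof -
      have "\<bar>e\<bar> * \<bar>t x\<bar> \<le> \<bar>e\<bar> * D"
        using T(2)[OF that \<open>x \<in> S\<close>] by (intro mult_left_mono) auto
      moreover have "e * \<bar>t x\<bar> \<le> \<bar>e\<bar> * \<bar>t x\<bar>" "e * t x \<le> \<bar>e\<bar> * \<bar>t x\<bar>"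
        by (simp_all add: mult_right_mono) (metis abs_ge_self abs_mult)
      ultimately show "e * \<bar>t x\<bar> \<le> \<bar>e\<bar> * D" "e * t x \<le> \<bar>e\<bar> * D" by linarith+
    qed
    show "bdd_above ((\<lambda>t. a t + e * \<bar>t x\<bar>) ` T)" "bdd_above ((\<lambda>t. a t + e * t x) ` T)"
      by (rule bdd_aboveI2[of _ _ "A + \<bar>e\<bar> * D"], use a le in \<open>force intro: add_mono\<close>)+
  qed
  have U: "a t + 2 * \<bar>t x\<bar> \<le> U x" and V: "a t - 2 * \<bar>t x\<bar> \<le> V x" if "t \<in> T" "x \<in> S" for t x
    unfolding U_def V_def using bdd(1)[OF that(2), of 2] bdd(1)[OF that(2), of "-2"] that(1)
    by (auto intro!: cSUP_upper)
  have meanU: "a t + 2 * (\<Sum>y\<in>S. p y * \<bar>t y\<bar>) \<le> (\<Sum>y\<in>S. p y * U y)"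
    and meanV: "a t - 2 * (\<Sum>y\<in>S. p y * \<bar>t y\<bar>) \<le> (\<Sum>y\<in>S. p y * V y)" if "t \<in> T" for t
  proof -
    have "a t + e * (\<Sum>y\<in>S. p y * \<bar>t y\<bar>) = (\<Sum>y\<in>S. p y * (a t + e * \<bar>t y\<bar>))" for e
      using S(3) by (simp add: distrib_left sum.distrib sum_distrib_left mult.left_commute
          flip: sum_distrib_right)
    from this[of 2] this[of "-2"]
    show "a t + 2 * (\<Sum>y\<in>S. p y * \<bar>t y\<bar>) \<le> (\<Sum>y\<in>S. p y * U y)"
      "a t - 2 * (\<Sum>y\<in>S. p y * \<bar>t y\<bar>) \<le> (\<Sum>y\<in>S. p y * V y)"
      using U V that by (auto intro!: sum_mono mult_left_mono S(2))
  qed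
  have "(\<Sum>x\<in>S. p x * (SUP t\<in>T. a t + \<sigma> * ((\<Sum>y\<in>S. p y * \<bar>t y\<bar>) - \<bar>t x\<bar>)))
      \<le> (\<Sum>y\<in>S. p y * ((U y + V y) / 2))"
  \<comment> \<open>For the sign 1 the expression is the average of \<open>a t\<close> plus twice
    the mean of \<open>|t|\<close>, which is at most the mean of \<open>U\<close>, and of
    \<open>a t - 2 * |t x|\<close>, which is at most \<open>V x\<close>. For the other sign
    \<open>U\<close> and \<open>V\<close> exchange roles.\<close>
  proof (cases "\<sigma> = 1")
    case True
    have "(SUP t\<in>T. a t + \<sigma> * ((\<Sum>y\<in>S. p y * \<bar>t y\<bar>) - \<bar>t x\<bar>))
      \<le> ((\<Sum>y\<in>S. p y * U y) + V x) / 2" if "x \<in> S" for x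
    proof (rule cSUP_least[OF T(1)])
      fix t assume "t \<in> T"
      show "a t + \<sigma> * ((\<Sum>y\<in>S. p y * \<bar>t y\<bar>) - \<bar>t x\<bar>) \<le> ((\<Sum>y\<in>S. p y * U y) + V x) / 2"
        using meanU[OF \<open>t \<in> T\<close>] V[OF \<open>t \<in> T\<close> that] True by simp
    qed
    then have "(\<Sum>x\<in>S. p x * (SUP t\<in>T. a t + \<sigma> * ((\<Sum>y\<in>S. p y * \<bar>t y\<bar>) - \<bar>t x\<bar>)))
      \<le> (\<Sum>x\<in>S. p x * (((\<Sum>y\<in>S. p y * U y) + V x) / 2))"
      by (intro sum_mono mult_left_mono S(2))
    also have "\<dots> = (\<Sum>y\<in>S. p y * ((U y + V y) / 2))"
      using S(3) by (simp add: distrib_left sum.distrib add_divide_distrib flip: sum_distrib_right sum_divide_distrib)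
    finally show ?thesis .
  next
    case False
    with \<sigma> have \<sigma>: "\<sigma> = - 1" by simp
    have "(SUP t\<in>T. a t + \<sigma> * ((\<Sum>y\<in>S. p y * \<bar>t y\<bar>) - \<bar>t x\<bar>))
      \<le> ((\<Sum>y\<in>S. p y * V y) + U x) / 2" if "x \<in> S" for x
    proof (rule cSUP_least[OF T(1)])
      fix t assume "t \<in> T"
      show "a t + \<sigma> * ((\<Sum>y\<in>S. p y * \<bar>t y\<bar>) - \<bar>t x\<bar>) \<le> ((\<Sum>y\<in>S. p y * V y) + U x) / 2"
        using meanV[OF \<open>t \<in> T\<close>] U[OF \<open>t \<in> T\<close> that] \<sigma> by simp
    qed
    then have "(\<Sum>x\<in>S. p x * (SUP t\<in>T. a t + \<sigma> * ((\<Sum>y\<in>S. p y * \<bar>t y\<bar>) - \<bar>t x\<bar>)))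
      \<le> (\<Sum>x\<in>S. p x * (((\<Sum>y\<in>S. p y * V y) + U x) / 2))"
      by (intro sum_mono mult_left_mono S(2))
    also have "\<dots> = (\<Sum>y\<in>S. p y * ((U y + V y) / 2))"
      using S(3) by (simp add: distrib_left sum.distrib add_divide_distrib flip: sum_distrib_right sum_divide_distrib)
    finally show ?thesis .
  qed
  also have "\<dots> \<le> (\<Sum>x\<in>S. p x * (((SUP t\<in>T. a t + 2 * t x) + (SUP t\<in>T. a t - 2 * t x)) / 2))"
  proof (intro sum_mono mult_left_mono S(2) divide_right_mono)
    fix x assume x: "x \<in> S"
    define R where "R = (SUP t\<in>T. a t + 2 * t x) + (SUP t\<in>T. a t - 2 * t x)"
    have pm: "a t + 2 * t x \<le> (SUP t\<in>T. a t + 2 * t x)" "a t - 2 * t x \<le> (SUP t\<in>T. a t - 2 * t x)"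
      if "t \<in> T" for t
      using bdd(2)[OF x, of 2] bdd(2)[OF x, of "-2"] that by (auto intro!: cSUP_upper)
    have "U x \<le> R - V x"
      unfolding U_def
    proof (rule cSUP_least[OF T(1)])
      fix s assume s: "s \<in> T"
      \<comment> \<open>The two suprema in \<open>R\<close> may be fed with \<open>s\<close> and
        \<open>t\<close> in either order. The two orders add \<open>2 * (s x - t x)\<close> or its
        negative to \<open>a s + a t\<close>, so \<open>R\<close> dominates
        \<open>a s + a t + 2 * |s x - t x|\<close>.\<close>
      have "V x \<le> R - (a s + 2 * \<bar>s x\<bar>)"
        unfolding V_def
      proof (rule cSUP_least[OF T(1)])
        fix t assume t: "t \<in> T"
        show "a t - 2 * \<bar>t x\<bar> \<le> R - (a s + 2 * \<bar>s x\<bar>)"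
          using pm[OF s] pm[OF t] unfolding R_def by linarith
      qed
      then show "a s + 2 * \<bar>s x\<bar> \<le> R - V x" by simp
    qed
    then show "U x + V x \<le> (SUP t\<in>T. a t + 2 * t x) + (SUP t\<in>T. a t - 2 * t x)"
      unfolding R_def by simp
  qed auto
  finally show ?thesis .
qed

lemma sum_sign_product:
  fixes f :: "'b \<times> real \<Rightarrow> real"
  shows "sum f (S \<times> {1, - 1}) = (\<Sum>x\<in>S. f (x, 1) + f (x, - 1))"
proof -
  have "sum f (S \<times> {1, - 1}) = (\<Sum>x\<in>S. \<Sum>e\<in>{1, - 1}. f (x, e))"
    by (simp only: sum.cartesian_product case_prod_eta)
  then show ?thesis by simp
qed

text \<open>Draws are replaced one at a time by draws with an independent fair sign. The offset
  \<open>a\<close> is arbitrary because it absorbs the other coordinates: the unsigned term of the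
  first draw in the induction hypothesis, the signed terms of the later draws in the one-step
  lemma.\<close>

lemma symmetrization_contraction:
  fixes T :: "('b \<Rightarrow> real) set"
  assumes S: "finite S" "\<And>x. x \<in> S \<Longrightarrow> 0 \<le> p x" "sum p S = 1"
    and T: "T \<noteq> {}" "\<And>t x. t \<in> T \<Longrightarrow> x \<in> S \<Longrightarrow> \<bar>t x\<bar> \<le> D"
    and a: "\<And>t. t \<in> T \<Longrightarrow> a t \<le> A"
    and \<sigma>: "\<sigma> = 1 \<or> \<sigma> = - 1"
  shows "list_mean p S k
      (\<lambda>xs. SUP t\<in>T. a t + (\<Sum>x\<leftarrow>xs. \<sigma> * ((\<Sum>y\<in>S. p y * \<bar>t y\<bar>) - \<bar>t x\<bar>)))
    \<le> list_mean (\<lambda>(x, e). p x / 2) (S \<times> {1, - 1}) k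
      (\<lambda>ys. SUP t\<in>T. a t + (\<Sum>(x, e)\<leftarrow>ys. 2 * e * t x))"
  using a
proof (induction k arbitrary: a A)
  case 0
  then show ?case by simp
next
  case (Suc k)
  let ?d = "\<lambda>t x. \<sigma> * ((\<Sum>y\<in>S. p y * \<bar>t y\<bar>) - \<bar>t x\<bar>)"
  let ?q = "\<lambda>(x, e::real). p x / 2" and ?R = "S \<times> {1, - 1::real}"
  let ?c = "\<lambda>t ys. \<Sum>(x, e)\<leftarrow>ys. 2 * e * t x"
  have q: "0 \<le> ?q z" if "z \<in> ?R" for z
    using that S(2) by auto
  have D: "0 \<le> D"
  proof -
    obtain x where "x \<in> S" using S(3) by fastforce
    then show ?thesis using T by fastforce
  qed
  have d: "?d t x \<le> D" if t: "t \<in> T" and x: "x \<in> S" for t x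
  proof -
    have "(\<Sum>y\<in>S. p y * \<bar>t y\<bar>) \<le> (\<Sum>y\<in>S. p y * D)"
      using T(2)[OF t] S(2) by (intro sum_mono mult_left_mono) auto
    also have "\<dots> = D" using S(3) by (simp flip: sum_distrib_right)
    finally have "(\<Sum>y\<in>S. p y * \<bar>t y\<bar>) \<le> D" .
    moreover have "0 \<le> (\<Sum>y\<in>S. p y * \<bar>t y\<bar>)"
      using S(2) by (intro sum_nonneg) auto
    ultimately show ?thesis
      using T(2)[OF t x] \<sigma> by auto
  qed
  have c: "?c t ys \<le> real (length ys) * (2 * D)" if t: "t \<in> T" and ys: "set ys \<subseteq> ?R" for t ys
    using ys
  proof (induction ys)
    case (Cons y ys)
    obtain x e where y: "y = (x, e)" by force
    have "e * t x \<le> D"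
      using Cons.prems y T(2)[OF t, of x] by auto
    with Cons y show ?case by (simp add: distrib_right)
  qed simp
  have "list_mean p S (Suc k) (\<lambda>xs. SUP t\<in>T. a t + (\<Sum>x\<leftarrow>xs. ?d t x))
    = (\<Sum>x\<in>S. p x * list_mean p S k (\<lambda>xs. SUP t\<in>T. (a t + ?d t x) + (\<Sum>x\<leftarrow>xs. ?d t x)))"
    by (simp add: add.assoc)
  also have "\<dots> \<le> (\<Sum>x\<in>S. p x * list_mean ?q ?R k (\<lambda>ys. SUP t\<in>T. (a t + ?d t x) + ?c t ys))"
    by (intro sum_mono mult_left_mono S(2) Suc.IH[where A = "A + D"])
      (use d Suc.prems in \<open>auto intro!: add_mono\<close>)
  also have "\<dots> = list_mean ?q ?R k (\<lambda>ys. \<Sum>x\<in>S. p x * (SUP t\<in>T. (a t + ?c t ys) + ?d t x))"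
    by (simp add: list_mean_sum list_mean_cmult add.commute add.left_commute)
  also have "\<dots> \<le> list_mean ?q ?R k (\<lambda>ys. \<Sum>x\<in>S. p x *
      (((SUP t\<in>T. (a t + ?c t ys) + 2 * t x) + (SUP t\<in>T. (a t + ?c t ys) - 2 * t x)) / 2))"
  proof (rule list_mean_mono[OF q])
    fix ys assume ys: "set ys \<subseteq> ?R"
    show "(\<Sum>x\<in>S. p x * (SUP t\<in>T. (a t + ?c t ys) + ?d t x)) \<le> (\<Sum>x\<in>S. p x *
      (((SUP t\<in>T. (a t + ?c t ys) + 2 * t x) + (SUP t\<in>T. (a t + ?c t ys) - 2 * t x)) / 2))"
      by (rule symmetrization_contraction_step[where D = D, OF S T(1), where A = "A + real (length ys) * (2 * D)"])
        (use T(2) Suc.prems c[OF _ ys] \<sigma> in \<open>auto intro!: add_mono\<close>)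
  qed
  also have "\<dots> = list_mean ?q ?R k (\<lambda>ys. \<Sum>x\<in>S. p x / 2 * (SUP t\<in>T. a t + ?c t ((x, 1) # ys)) +
      p x / 2 * (SUP t\<in>T. a t + ?c t ((x, - 1) # ys)))"
  proof -
    have "(SUP t\<in>T. (a t + ?c t ys) + 2 * t x) = (SUP t\<in>T. a t + ?c t ((x, 1) # ys))"
      "(SUP t\<in>T. (a t + ?c t ys) - 2 * t x) = (SUP t\<in>T. a t + ?c t ((x, - 1) # ys))" for ys x
      by (rule SUP_cong; simp)+
    moreover have "u * ((v + w) / 2) = u / 2 * v + u / 2 * w" for u v w :: real
      by (simp add: field_simps)
    ultimately show ?thesis by (simp only:)
  qed
  also have "\<dots> = (\<Sum>z\<in>?R. ?q z * list_mean ?q ?R k (\<lambda>ys. SUP t\<in>T. a t + ?c t (z # ys)))"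
    by (simp only: list_mean_sum list_mean_add list_mean_cmult sum_sign_product split_conv)
  also have "\<dots> = list_mean ?q ?R (Suc k) (\<lambda>ys. SUP t\<in>T. a t + ?c t ys)"
    by (simp only: list_mean.simps)
  finally show ?case .
qed

section \<open>Exponential moments of signed sums\<close>

lemma exp_le_quadratic:
  fixes u :: real
  assumes "\<bar>u\<bar> \<le> 1"
  shows "exp u \<le> 1 + u + u\<^sup>2"
proof (cases "0 \<le> u")
  case True
  then show ?thesis using exp_bound[of u] assms by simp
next
  case False
  define v where "v = - u"
  have v: "0 \<le> v" "v \<le> 1" using False assms by (auto simp: v_def)
  \<comment> \<open>The product equals \<open>1 + v ^ 3\<close>.\<close>
  have "1 \<le> (1 + v) * (1 - v + v\<^sup>2)"
    using v by (simp add: algebra_simps power2_eq_square)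
  also have "\<dots> \<le> exp v * (1 - v + v\<^sup>2)"
    using v by (intro mult_right_mono) (auto simp: exp_ge_add_one_self)
  finally have "exp (- v) \<le> 1 - v + v\<^sup>2"
    by (simp add: exp_minus field_simps)
  then show ?thesis by (simp add: v_def)
qed

text \<open>Young's inequality for the exponential, with \<open>a * ln D\<close> in place of the
  entropy of \<open>a\<close>. For \<open>u = b - L - ln D\<close> it reads
  \<open>a * u \<le> D * exp u\<close>, which is clear for \<open>u \<le> 0\<close> and otherwise
  follows from \<open>u \<le> exp u\<close>. The free parameter \<open>L\<close> serves to normalize
  an exponential moment.\<close>

lemma young_exp:
  fixes a b D L :: real
  assumes "0 \<le> a" "a \<le> D" "0 < D"
  shows "a * b \<le> a * (L + ln D) + exp (b - L)"
proof -
  let ?u = "b - L - ln D"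
  have "a * ?u \<le> D * exp ?u"
  proof (cases "?u \<le> 0")
    case True
    then show ?thesis
      using assms by (meson exp_ge_zero less_imp_le mult_nonneg_nonneg mult_nonneg_nonpos order_trans)
  next
    case False
    then show ?thesis
    proof (intro mult_mono)
      show "?u \<le> exp ?u" using exp_ge_add_one_self[of ?u] by linarith
    qed (use assms in auto)
  qed
  also have "D * exp ?u = exp (b - L)"
    using assms by (simp add: exp_diff)
  finally show ?thesis by (simp add: algebra_simps)
qed

text \<open>The kernel identity writes the signed sum of \<open>t\<close> as the inner product of
  \<open>t\<close> with the signed sum \<open>F\<close> of kernel sections. Young's inequality then
  leaves only the L1 norm and the uniform bound of \<open>t\<close>, so the supremum over
  \<open>T\<close> disappears and the exponential moment of \<open>F\<close> can be estimated for
  one \<open>y\<close> at a time.\<close>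

lemma rademacher_bound:
  fixes T :: "('b \<Rightarrow> real) set" and K :: "'b \<Rightarrow> 'b \<Rightarrow> real"
  assumes S: "finite S" "\<And>x. x \<in> S \<Longrightarrow> 0 \<le> p x" "sum p S = 1"
    and D: "1 \<le> D"
    and K: "\<And>x y. x \<in> S \<Longrightarrow> y \<in> S \<Longrightarrow> \<bar>K x y\<bar> \<le> D"
    and K2: "\<And>y. y \<in> S \<Longrightarrow> (\<Sum>x\<in>S. p x * (K x y)\<^sup>2) \<le> D"
    and T: "T \<noteq> {}"
    and rep: "\<And>t x. t \<in> T \<Longrightarrow> x \<in> S \<Longrightarrow> t x = (\<Sum>y\<in>S. p y * (K x y * t y))"
    and norm: "\<And>t. t \<in> T \<Longrightarrow> (\<Sum>y\<in>S. p y * \<bar>t y\<bar>) \<le> 1"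
    and bd: "\<And>t x. t \<in> T \<Longrightarrow> x \<in> S \<Longrightarrow> \<bar>t x\<bar> \<le> D"
    and m: "256 * D * (ln D + 2) \<le> real m"
  shows "list_mean (\<lambda>(x, e). p x / 2) (S \<times> {1, - 1}) m
      (\<lambda>ys. SUP t\<in>T. (\<Sum>(x, e)\<leftarrow>ys. 2 * e * t x)) \<le> real m / 4"
proof -
  let ?q = "\<lambda>(x, e::real). p x / 2" and ?R = "S \<times> {1, - 1::real}"
  \<comment> \<open>\<open>\<theta> * D \<le> 1\<close> permits the quadratic bound on the
    exponential, and \<open>2 / \<theta> * (m * \<theta>\<^sup>2 * D)\<close> becomes
    \<open>m / 8\<close>. \<open>L\<close> makes
    \<open>2 * exp (m * \<theta>\<^sup>2 * D) * exp (- L)\<close> equal to 1; the factor 2 pays for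
    replacing \<open>exp (\<theta> * |F|)\<close> by the sum over both signs of
    \<open>F\<close>.\<close>
  define \<theta> where "\<theta> = 1 / (16 * D)"
  define L where "L = ln 2 + real m * (\<theta>\<^sup>2 * D)"
  define F where "F ys y = (\<Sum>(x, e)\<leftarrow>ys. e * K x y)" for ys :: "('b \<times> real) list" and y
  have \<theta>: "0 < \<theta>" using D by (simp add: \<theta>_def)
  have L: "0 \<le> L" using D by (simp add: L_def)
  have q: "0 \<le> ?q z" if "z \<in> ?R" for z
    using that S(2) by auto
  have dual: "(\<Sum>(x, e)\<leftarrow>ys. e * t x) = (\<Sum>y\<in>S. p y * (t y * F ys y))"
    if t: "t \<in> T" and "set ys \<subseteq> ?R" for t ys
    using that(2)
  proof (induction ys)
    case Nil
    then show ?case by (simp add: F_def)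
  next
    case (Cons z ys)
    obtain x e where z: "z = (x, e)" by force
    then have x: "x \<in> S" using Cons.prems by auto
    show ?case
      using Cons z rep[OF t x]
      by (simp add: F_def distrib_left sum.distrib sum_distrib_left ac_simps)
  qed
  have sup: "(SUP t\<in>T. (\<Sum>(x, e)\<leftarrow>ys. 2 * e * t x))
      \<le> 2 / \<theta> * (L + ln D + (\<Sum>y\<in>S. p y * exp (\<theta> * \<bar>F ys y\<bar> - L)))"
    if ys: "set ys \<subseteq> ?R" for ys
  proof (rule cSUP_least[OF T])
    fix t assume t: "t \<in> T"
    have "(\<Sum>(x, e)\<leftarrow>ys. 2 * e * t x) = 2 * (\<Sum>(x, e)\<leftarrow>ys. e * t x)"
      by (induction ys) (auto simp: distrib_left)
    also have "\<dots> = 2 / \<theta> * (\<Sum>y\<in>S. p y * (t y * (\<theta> * F ys y)))"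
      using dual[OF t ys] \<theta> by (simp add: sum_distrib_left field_simps)
    also have "\<dots> \<le> 2 / \<theta> * (\<Sum>y\<in>S. p y * (\<bar>t y\<bar> * (L + ln D) + exp (\<theta> * \<bar>F ys y\<bar> - L)))"
    proof (intro mult_left_mono sum_mono S(2))
      fix y assume y: "y \<in> S"
      have "t y * (\<theta> * F ys y) \<le> \<bar>t y\<bar> * (\<theta> * \<bar>F ys y\<bar>)"
        using \<theta> by (metis abs_ge_self abs_mult abs_of_pos)
      also have "\<dots> \<le> \<bar>t y\<bar> * (L + ln D) + exp (\<theta> * \<bar>F ys y\<bar> - L)"
        using young_exp[of "\<bar>t y\<bar>" D] bd[OF t y] D by simp
      finally show "t y * (\<theta> * F ys y) \<le> \<bar>t y\<bar> * (L + ln D) + exp (\<theta> * \<bar>F ys y\<bar> - L)" .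
    qed (use \<theta> in auto)
    also have "\<dots> = 2 / \<theta> * ((\<Sum>y\<in>S. p y * \<bar>t y\<bar>) * (L + ln D)
        + (\<Sum>y\<in>S. p y * exp (\<theta> * \<bar>F ys y\<bar> - L)))"
      by (simp add: distrib_left sum.distrib sum_distrib_right mult.assoc)
    also have "\<dots> \<le> 2 / \<theta> * (1 * (L + ln D) + (\<Sum>y\<in>S. p y * exp (\<theta> * \<bar>F ys y\<bar> - L)))"
      using norm[OF t] L D \<theta> by (intro mult_left_mono add_mono mult_right_mono) auto
    finally show "(\<Sum>(x, e)\<leftarrow>ys. 2 * e * t x)
      \<le> 2 / \<theta> * (L + ln D + (\<Sum>y\<in>S. p y * exp (\<theta> * \<bar>F ys y\<bar> - L)))" by simp
  qed
  have mgf: "list_mean ?q ?R m (\<lambda>ys. exp (s * F ys y)) \<le> exp (real m * (\<theta>\<^sup>2 * D))"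
    if y: "y \<in> S" and s: "s = \<theta> \<or> s = - \<theta>" for s y
  proof -
    have s2: "s\<^sup>2 = \<theta>\<^sup>2" using s by auto
    have "exp (s * F ys y) = prod_list (map (\<lambda>(x, e). exp (s * (e * K x y))) ys)" for ys
      by (induction ys) (auto simp: F_def distrib_left exp_add)
    then have "list_mean ?q ?R m (\<lambda>ys. exp (s * F ys y))
        = (\<Sum>z\<in>?R. ?q z * (case z of (x, e) \<Rightarrow> exp (s * (e * K x y)))) ^ m"
      by (simp only: list_mean_prod_list)
    also have "(\<Sum>z\<in>?R. ?q z * (case z of (x, e) \<Rightarrow> exp (s * (e * K x y))))
      = (\<Sum>x\<in>S. p x * ((exp (s * K x y) + exp (- (s * K x y))) / 2))"
      by (subst sum_sign_product) (simp add: field_simps)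
    also have "\<dots> ^ m \<le> exp (\<theta>\<^sup>2 * D) ^ m"
    proof (rule power_mono)
      have "(\<Sum>x\<in>S. p x * ((exp (s * K x y) + exp (- (s * K x y))) / 2))
          \<le> (\<Sum>x\<in>S. p x * (1 + \<theta>\<^sup>2 * (K x y)\<^sup>2))"
      proof (intro sum_mono mult_left_mono S(2))
        fix x assume x: "x \<in> S"
        have "\<bar>s * K x y\<bar> \<le> \<theta> * D"
          using s \<theta> K[OF x y] by (auto simp: abs_mult intro!: mult_left_mono)
        also have "\<dots> \<le> 1" using D by (simp add: \<theta>_def)
        finally have u: "\<bar>s * K x y\<bar> \<le> 1" .
        \<comment> \<open>Averaging over the fair sign cancels the linear terms, so only the second
          moment of \<open>K\<close>, bounded in \<open>K2\<close>, enters.\<close>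
        show "(exp (s * K x y) + exp (- (s * K x y))) / 2 \<le> 1 + \<theta>\<^sup>2 * (K x y)\<^sup>2"
          using exp_le_quadratic[OF u] exp_le_quadratic[of "- (s * K x y)"] u
          by (simp add: power_mult_distrib s2)
      qed
      also have "\<dots> = 1 + \<theta>\<^sup>2 * (\<Sum>x\<in>S. p x * (K x y)\<^sup>2)"
        using S(3) by (simp add: distrib_left sum.distrib sum_distrib_left ac_simps)
      also have "\<dots> \<le> 1 + \<theta>\<^sup>2 * D"
        using K2[OF y] by (intro add_left_mono mult_left_mono) auto
      also have "\<dots> \<le> exp (\<theta>\<^sup>2 * D)" by (rule exp_ge_add_one_self)
      finally show "(\<Sum>x\<in>S. p x * ((exp (s * K x y) + exp (- (s * K x y))) / 2)) \<le> exp (\<theta>\<^sup>2 * D)" .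
    qed (use S(2) in \<open>auto intro!: sum_nonneg\<close>)
    finally show ?thesis by (simp add: exp_of_nat_mult)
  qed
  have one: "list_mean ?q ?R m (\<lambda>ys. \<Sum>y\<in>S. p y * exp (\<theta> * \<bar>F ys y\<bar> - L)) \<le> 1"
  proof -
    have "list_mean ?q ?R m (\<lambda>ys. exp (\<theta> * \<bar>F ys y\<bar> - L)) \<le> 1" if y: "y \<in> S" for y
    proof -
      have "list_mean ?q ?R m (\<lambda>ys. exp (\<theta> * \<bar>F ys y\<bar> - L))
        \<le> list_mean ?q ?R m (\<lambda>ys. exp (- L) * (exp (\<theta> * F ys y) + exp (- \<theta> * F ys y)))"
      proof (rule list_mean_mono[OF q])
        fix ys :: "('b \<times> real) list"
        show "exp (\<theta> * \<bar>F ys y\<bar> - L) \<le> exp (- L) * (exp (\<theta> * F ys y) + exp (- \<theta> * F ys y))"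
          by (cases "0 \<le> F ys y") (auto simp: exp_diff exp_minus field_simps)
      qed
      also have "\<dots> \<le> exp (- L) * (exp (real m * (\<theta>\<^sup>2 * D)) + exp (real m * (\<theta>\<^sup>2 * D)))"
        unfolding list_mean_cmult list_mean_add
        by (intro mult_left_mono add_mono mgf y) auto
      also have "\<dots> = 1"
        by (simp add: L_def exp_minus exp_diff field_simps)
      finally show ?thesis .
    qed
    then have "list_mean ?q ?R m (\<lambda>ys. \<Sum>y\<in>S. p y * exp (\<theta> * \<bar>F ys y\<bar> - L)) \<le> (\<Sum>y\<in>S. p y * 1)"
      unfolding list_mean_sum list_mean_cmult by (intro sum_mono mult_left_mono S(2))
    then show ?thesis using S(3) by simp
  qed
  have sumq: "sum ?q ?R = 1"
    by (subst sum_sign_product) (simp add: S(3))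
  have "list_mean ?q ?R m (\<lambda>ys. SUP t\<in>T. (\<Sum>(x, e)\<leftarrow>ys. 2 * e * t x))
    \<le> list_mean ?q ?R m (\<lambda>ys. 2 / \<theta> * (L + ln D + (\<Sum>y\<in>S. p y * exp (\<theta> * \<bar>F ys y\<bar> - L))))"
    by (rule list_mean_mono[OF q sup])
  also have "\<dots> \<le> 2 / \<theta> * (L + ln D + 1)"
    unfolding list_mean_cmult list_mean_add list_mean_const[OF sumq]
    using one \<theta> by (intro mult_left_mono add_mono) auto
  also have "\<dots> = 32 * D * (ln 2 + ln D + 1) + real m / 8"
    using D by (simp add: \<theta>_def L_def field_simps power2_eq_square)
  also have "\<dots> \<le> 32 * D * (ln D + 2) + real m / 8"
    using ln_le_minus_one[of 2] D by (intro add_right_mono mult_left_mono) auto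
  \<comment> \<open>Since 256 = 8 * 32, the hypothesis on \<open>m\<close> bounds the first term by
    \<open>m / 8\<close>.\<close>
  also have "\<dots> \<le> real m / 4"
    using m by simp
  finally show ?thesis .
qed

text \<open>Deviations of both signs must be small for the same sample. Their suprema together have
  mean at most \<open>m / 2\<close>, so some sample keeps the sum of the two below this value. Each
  supremum is nonnegative because \<open>T\<close> contains the zero function, so each one
  separately is below it too.\<close>

lemma sampling_absolute_means:
  fixes T :: "('b \<Rightarrow> real) set" and K :: "'b \<Rightarrow> 'b \<Rightarrow> real"
  assumes S: "finite S" "\<And>x. x \<in> S \<Longrightarrow> 0 \<le> p x" "sum p S = 1"
    and D: "1 \<le> D"
    and K: "\<And>x y. x \<in> S \<Longrightarrow> y \<in> S \<Longrightarrow> \<bar>K x y\<bar> \<le> D"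
    and K2: "\<And>y. y \<in> S \<Longrightarrow> (\<Sum>x\<in>S. p x * (K x y)\<^sup>2) \<le> D"
    and T: "(\<lambda>x. 0) \<in> T"
    and rep: "\<And>t x. t \<in> T \<Longrightarrow> x \<in> S \<Longrightarrow> t x = (\<Sum>y\<in>S. p y * (K x y * t y))"
    and norm: "\<And>t. t \<in> T \<Longrightarrow> (\<Sum>y\<in>S. p y * \<bar>t y\<bar>) \<le> 1"
    and m: "256 * D * (ln D + 2) \<le> real m"
  shows "\<exists>xs. set xs \<subseteq> S \<and> length xs = m \<and>
    (\<forall>t\<in>T. \<bar>real m * (\<Sum>y\<in>S. p y * \<bar>t y\<bar>) - (\<Sum>x\<leftarrow>xs. \<bar>t x\<bar>)\<bar> \<le> real m / 2)"
proof -
  let ?d = "\<lambda>\<sigma> t xs. \<Sum>x\<leftarrow>xs. \<sigma> * ((\<Sum>y\<in>S. p y * \<bar>t y\<bar>) - \<bar>t x\<bar>)"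
  have Tne: "T \<noteq> {}" using T by auto
  \<comment> \<open>The kernel identity turns the L1 bound into the uniform bound that Young's
    inequality needs.\<close>
  have bd: "\<bar>t x\<bar> \<le> D" if t: "t \<in> T" and x: "x \<in> S" for t x
  proof -
    have "\<bar>t x\<bar> \<le> (\<Sum>y\<in>S. \<bar>p y * (K x y * t y)\<bar>)"
      by (subst rep[OF t x]) (rule sum_abs)
    also have "\<dots> = (\<Sum>y\<in>S. p y * \<bar>t y\<bar> * \<bar>K x y\<bar>)"
      using S(2) by (intro sum.cong) (auto simp: abs_mult)
    also have "\<dots> \<le> (\<Sum>y\<in>S. p y * \<bar>t y\<bar> * D)"
      using S(2) K[OF x] by (intro sum_mono mult_left_mono) auto
    also have "\<dots> \<le> 1 * D"
      using norm[OF t] D by (subst sum_distrib_right[symmetric]) (intro mult_right_mono, auto)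
    finally show ?thesis by simp
  qed
  have d_eq: "?d \<sigma> t xs = \<sigma> * (real (length xs) * (\<Sum>y\<in>S. p y * \<bar>t y\<bar>) - (\<Sum>x\<leftarrow>xs. \<bar>t x\<bar>))" for \<sigma> t xs
    by (induction xs) (simp_all add: algebra_simps)
  have mean: "list_mean p S m (\<lambda>xs. SUP t\<in>T. ?d \<sigma> t xs) \<le> real m / 4" if "\<sigma> = 1 \<or> \<sigma> = - 1" for \<sigma>
  proof -
    have "list_mean p S m (\<lambda>xs. SUP t\<in>T. 0 + ?d \<sigma> t xs)
      \<le> list_mean (\<lambda>(x, e). p x / 2) (S \<times> {1, - 1}) m (\<lambda>ys. SUP t\<in>T. 0 + (\<Sum>(x, e)\<leftarrow>ys. 2 * e * t x))"
      by (rule symmetrization_contraction[where A = 0 and D = D, OF S Tne])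
        (use bd that in auto)
    also have "\<dots> \<le> real m / 4"
      using rademacher_bound[of S p D K T m] assms Tne bd by simp
    finally show ?thesis by simp
  qed
  have "list_mean p S m (\<lambda>xs. (SUP t\<in>T. ?d 1 t xs) + (SUP t\<in>T. ?d (- 1) t xs)) \<le> real m / 2"
    unfolding list_mean_add using mean[of 1] mean[of "- 1"] by simp
  from list_mean_le_imp_ex[OF S this] obtain xs where xs: "set xs \<subseteq> S" "length xs = m"
    "(SUP t\<in>T. ?d 1 t xs) + (SUP t\<in>T. ?d (- 1) t xs) \<le> real m / 2" by blast
  have up: "?d \<sigma> t xs \<le> (SUP t\<in>T. ?d \<sigma> t xs)" if "\<sigma> = 1 \<or> \<sigma> = - 1" "t \<in> T" for \<sigma> t
  proof (rule cSUP_upper[OF that(2)], rule bdd_aboveI2)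
    fix t assume t: "t \<in> T"
    have sum_le: "(\<Sum>x\<leftarrow>zs. \<bar>t x\<bar>) \<le> real (length zs) * D" if "set zs \<subseteq> S" for zs
      using that by (induction zs) (use bd[OF t] in \<open>auto simp: distrib_right intro!: add_mono\<close>)
    have "0 \<le> (\<Sum>x\<leftarrow>xs. \<bar>t x\<bar>)"
      by (rule sum_list_nonneg) auto
    moreover have "0 \<le> real m * (\<Sum>y\<in>S. p y * \<bar>t y\<bar>)"
      using S(2) by (intro mult_nonneg_nonneg sum_nonneg) auto
    moreover have "real m * (\<Sum>y\<in>S. p y * \<bar>t y\<bar>) \<le> real m * 1"
      by (intro mult_left_mono norm t) auto
    ultimately show "?d \<sigma> t xs \<le> real m + real m * D"
      using sum_le[OF xs(1)] xs(2) that(1) by (auto simp: d_eq)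
  qed
  have nonneg: "0 \<le> (SUP t\<in>T. ?d \<sigma> t xs)" if "\<sigma> = 1 \<or> \<sigma> = - 1" for \<sigma>
    using up[OF that T] by (simp add: d_eq)
  show ?thesis
  proof (intro exI conjI ballI)
    fix t assume t: "t \<in> T"
    have "?d 1 t xs \<le> real m / 2" "?d (- 1) t xs \<le> real m / 2"
      using up[of 1, OF _ t] up[of "- 1", OF _ t] nonneg[of 1] nonneg[of "- 1"] xs(3) by linarith+
    then show "\<bar>real m * (\<Sum>y\<in>S. p y * \<bar>t y\<bar>) - (\<Sum>x\<leftarrow>xs. \<bar>t x\<bar>)\<bar> \<le> real m / 2"
      unfolding d_eq unfolding xs(2) mult_1_left mult_minus1 by linarith
  qed (use xs in auto)
qed

section \<open>Orthonormal systems in finite-dimensional function spaces\<close>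

lemma fspanI: "(\<lambda>x. \<Sum>i<n. c i * u i x) \<in> fspan n u"
  by (auto simp: fspan_def)

lemma fspan_add: "f \<in> fspan n u \<Longrightarrow> g \<in> fspan n u \<Longrightarrow> (\<lambda>x. f x + g x) \<in> fspan n u"
  unfolding fspan_def
  by (clarsimp, rule_tac x = "\<lambda>i. c i + ca i" in exI) (simp add: distrib_right sum.distrib)

lemma fspan_cmult: "f \<in> fspan n u \<Longrightarrow> (\<lambda>x. a * f x) \<in> fspan n u"
  unfolding fspan_def
  by (clarsimp, rule_tac x = "\<lambda>i. a * c i" in exI) (simp add: sum_distrib_left mult.assoc)

lemma fspan_zero: "(\<lambda>x. 0) \<in> fspan n u"
  using fspanI[where n = n and u = u and c = "\<lambda>_. 0"] by simp

lemma fspan_sum: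
  "(\<And>i. i \<in> I \<Longrightarrow> f i \<in> fspan n u) \<Longrightarrow> (\<lambda>x. \<Sum>i\<in>I. f i x) \<in> fspan n u"
  by (induction I rule: infinite_finite_induct) (auto simp: fspan_zero intro!: fspan_add)

lemma fspan_sum_cmult:
  "(\<And>i. i \<in> I \<Longrightarrow> f i \<in> fspan n u) \<Longrightarrow> (\<lambda>x. \<Sum>i\<in>I. c i * f i x) \<in> fspan n u"
  by (intro fspan_sum fspan_cmult)

lemma fspan_base: "i < n \<Longrightarrow> u i \<in> fspan n u"
  using fspanI[where n = n and u = u and c = "\<lambda>j. if j = i then 1 else 0"]
  by (simp add: of_bool_def[symmetric])

lemma fspan_mono: "m \<le> n \<Longrightarrow> fspan m u \<subseteq> fspan n u"
  unfolding fspan_def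
  by (clarsimp, rule_tac x = "\<lambda>i. if i < m then c i else 0" in exI)
    (auto intro!: ext sum.mono_neutral_cong_left split: if_splits)

text \<open>The form may be degenerate: a function vanishing almost everywhere has square zero under
  an integral. The laws are restricted to \<open>V\<close> because integrals are additive only where
  they converge.\<close>

locale semi_inner_product =
  fixes V :: "('a \<Rightarrow> real) set" and B :: "('a \<Rightarrow> real) \<Rightarrow> ('a \<Rightarrow> real) \<Rightarrow> real"
  assumes zero_mem: "(\<lambda>x. 0) \<in> V"
    and add_mem: "f \<in> V \<Longrightarrow> g \<in> V \<Longrightarrow> (\<lambda>x. f x + g x) \<in> V"
    and cmult_mem: "f \<in> V \<Longrightarrow> (\<lambda>x. c * f x) \<in> V"
    and sym: "f \<in> V \<Longrightarrow> g \<in> V \<Longrightarrow> B f g = B g f"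
    and add_left: "f \<in> V \<Longrightarrow> g \<in> V \<Longrightarrow> h \<in> V \<Longrightarrow> B (\<lambda>x. f x + g x) h = B f h + B g h"
    and cmult_left: "f \<in> V \<Longrightarrow> h \<in> V \<Longrightarrow> B (\<lambda>x. c * f x) h = c * B f h"
    and nonneg: "f \<in> V \<Longrightarrow> 0 \<le> B f f"
begin

lemma sum_mem: "(\<And>i. i \<in> I \<Longrightarrow> f i \<in> V) \<Longrightarrow> (\<lambda>x. \<Sum>i\<in>I. f i x) \<in> V"
  by (induction I rule: infinite_finite_induct) (auto simp: zero_mem intro!: add_mem)

lemma zero_left: "h \<in> V \<Longrightarrow> B (\<lambda>x. 0) h = 0"
  using cmult_left[OF zero_mem, of h 0] by simp

lemma sum_left:
  "(\<And>i. i \<in> I \<Longrightarrow> f i \<in> V) \<Longrightarrow> h \<in> V \<Longrightarrow> B (\<lambda>x. \<Sum>i\<in>I. f i x) h = (\<Sum>i\<in>I. B (f i) h)"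
  by (induction I rule: infinite_finite_induct) (auto simp: zero_left add_left sum_mem)

lemma sum_cmult_left:
  "(\<And>i. i \<in> I \<Longrightarrow> f i \<in> V) \<Longrightarrow> h \<in> V \<Longrightarrow>
    B (\<lambda>x. \<Sum>i\<in>I. c i * f i x) h = (\<Sum>i\<in>I. c i * B (f i) h)"
  by (subst sum_left) (auto intro!: cmult_mem sum.cong cmult_left)

lemma diff_mem: "f \<in> V \<Longrightarrow> g \<in> V \<Longrightarrow> (\<lambda>x. f x - g x) \<in> V"
  using add_mem[of f "\<lambda>x. (- 1) * g x"] cmult_mem[of g "- 1"] by simp

lemma diff_left: "f \<in> V \<Longrightarrow> g \<in> V \<Longrightarrow> h \<in> V \<Longrightarrow> B (\<lambda>x. f x - g x) h = B f h - B g h"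
  using add_left[of f "\<lambda>x. (- 1) * g x" h] cmult_mem[of g "- 1"] cmult_left[of g h "- 1"] by simp

text \<open>As the form may be degenerate, the residual of each \<open>z j\<close> is only required
  to have square zero; and \<open>r\<close> may be smaller than \<open>n\<close> when the
  \<open>z j\<close> are dependent modulo such functions.\<close>

definition spans_orthonormally :: "nat \<Rightarrow> (nat \<Rightarrow> 'a \<Rightarrow> real) \<Rightarrow> nat \<Rightarrow> (nat \<Rightarrow> 'a \<Rightarrow> real) \<Rightarrow> bool" where
  "spans_orthonormally n z r \<phi> \<longleftrightarrow> r \<le> n \<and> (\<forall>i<r. \<phi> i \<in> fspan n z) \<and> (\<forall>i<r. \<phi> i \<in> V)
    \<and> (\<forall>i<r. \<forall>j<r. B (\<phi> i) (\<phi> j) = (if i = j then 1 else 0))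
    \<and> (\<forall>j<n. \<exists>a. B (\<lambda>x. z j x - (\<Sum>i<r. a i * \<phi> i x)) (\<lambda>x. z j x - (\<Sum>i<r. a i * \<phi> i x)) = 0)"

definition nondegenerate :: "nat \<Rightarrow> (nat \<Rightarrow> 'a \<Rightarrow> real) \<Rightarrow> bool" where
  "nondegenerate n z \<longleftrightarrow>
    (\<forall>c. B (\<lambda>x. \<Sum>i<n. c i * z i x) (\<lambda>x. \<Sum>i<n. c i * z i x) = 0 \<longrightarrow> (\<forall>i<n. c i = 0))"

lemma spans_orthonormallyD:
  assumes "spans_orthonormally n z r \<phi>"
  shows "r \<le> n"
    and "i < r \<Longrightarrow> \<phi> i \<in> fspan n z"
    and "i < r \<Longrightarrow> \<phi> i \<in> V"
    and "i < r \<Longrightarrow> j < r \<Longrightarrow> B (\<phi> i) (\<phi> j) = (if i = j then 1 else 0)"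
    and "\<exists>a. \<forall>j<n. B (\<lambda>x. z j x - (\<Sum>i<r. a j i * \<phi> i x)) (\<lambda>x. z j x - (\<Sum>i<r. a j i * \<phi> i x)) = 0"
  using assms unfolding spans_orthonormally_def by (auto simp: choice_iff')

text \<open>The Gram-Schmidt process that skips a vector whose residual \<open>e\<close> has square
  zero. A residual is a combination of the \<open>z i\<close> with last coefficient 1, so in the
  nondegenerate case nothing is ever skipped.\<close>

lemma gram_schmidt:
  assumes "\<And>i. i < n \<Longrightarrow> z i \<in> V"
  shows "\<exists>r \<phi>. spans_orthonormally n z r \<phi> \<and> (nondegenerate n z \<longrightarrow> r = n)"
  using assms
proof (induction n)
  case 0
  show ?case by (rule exI[of _ 0]) (simp add: spans_orthonormally_def)
next
  case (Suc n)
  let ?res = "\<lambda>r \<phi> j a x. z j x - (\<Sum>i<r. a i * \<phi> i x)"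
  have "\<exists>r \<phi>. spans_orthonormally n z r \<phi> \<and> (nondegenerate n z \<longrightarrow> r = n)"
    by (rule Suc.IH) (simp add: Suc.prems)
  then obtain r \<phi> where H: "spans_orthonormally n z r \<phi>"
    and indep: "nondegenerate n z \<Longrightarrow> r = n"
    by blast
  have r: "r \<le> n"
    and mem: "\<And>i. i < r \<Longrightarrow> \<phi> i \<in> fspan n z" "\<And>i. i < r \<Longrightarrow> \<phi> i \<in> V"
    and orth: "\<And>i j. i < r \<Longrightarrow> j < r \<Longrightarrow> B (\<phi> i) (\<phi> j) = (if i = j then 1 else 0)"
    and span: "\<And>j. j < n \<Longrightarrow> \<exists>a. B (?res r \<phi> j a) (?res r \<phi> j a) = 0"
    using H unfolding spans_orthonormally_def by simp_all
  have znV: "z n \<in> V" using Suc.prems by simp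
  define b where "b i = B (z n) (\<phi> i)" for i
  define e where "e = ?res r \<phi> n b"
  have eV: "e \<in> V"
    unfolding e_def by (intro diff_mem znV sum_mem cmult_mem mem) auto
  have e_orth: "B e (\<phi> j) = 0" if j: "j < r" for j
  proof -
    have "B e (\<phi> j) = B (z n) (\<phi> j) - (\<Sum>i<r. b i * B (\<phi> i) (\<phi> j))"
      unfolding e_def using mem j
      by (subst diff_left) (auto intro!: znV sum_mem cmult_mem sum_cmult_left)
    also have "(\<Sum>i<r. b i * B (\<phi> i) (\<phi> j)) = b j"
      using orth j by (simp add: if_distrib[of "\<lambda>u. _ * u"] cong: if_cong)
    finally show ?thesis by (simp add: b_def)
  qed
  have mem': "\<phi> i \<in> fspan (Suc n) z" if "i < r" for i
    using mem(1)[OF that] fspan_mono[of n "Suc n" z] by auto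
  have e_span: "e \<in> fspan (Suc n) z"
  proof -
    have "(\<lambda>x. z n x + (- 1) * (\<Sum>i<r. b i * \<phi> i x)) \<in> fspan (Suc n) z"
      by (intro fspan_add fspan_cmult fspan_base fspan_sum_cmult mem') auto
    then show ?thesis by (simp add: e_def)
  qed
  show ?case
  proof (cases "B e e = 0")
    case True
    have indep': "r = Suc n" if H: "nondegenerate (Suc n) z"
    proof -
      have "(\<lambda>x. \<Sum>i<r. b i * \<phi> i x) \<in> fspan n z"
        by (intro fspan_sum_cmult mem) auto
      then obtain c where c: "(\<lambda>x. \<Sum>i<r. b i * \<phi> i x) = (\<lambda>x. \<Sum>i<n. c i * z i x)"
        by (auto simp: fspan_def)
      define c' where "c' i = (if i = n then 1 else - c i)" for i
      have "e = (\<lambda>x. \<Sum>i<Suc n. c' i * z i x)"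
        unfolding e_def by (auto simp: c'_def fun_cong[OF c] sum_negf)
      with H True have "c' n = 0" by (simp add: nondegenerate_def)
      then show ?thesis by (simp add: c'_def)
    qed
    have "\<exists>a. B (?res r \<phi> j a) (?res r \<phi> j a) = 0" if "j < Suc n" for j
      
    proof (cases "j = n")
      case True
      with \<open>B e e = 0\<close> show ?thesis unfolding e_def by blast
    next
      case False
      with that show ?thesis by (intro span) simp
    qed
    then have "spans_orthonormally (Suc n) z r \<phi>"
      using r mem(2) mem' orth unfolding spans_orthonormally_def by simp
    with indep' show ?thesis by blast
  next
    case False
    then have pos: "0 < B e e" using nonneg[OF eV] by simp
    define s where "s = sqrt (B e e)"
    have s: "s > 0" "s * s = B e e" using pos by (auto simp: s_def)
    define \<psi> where "\<psi> i = (if i = r then (\<lambda>x. 1 / s * e x) else \<phi> i)" for i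
    have \<psi>V: "\<psi> i \<in> V" if "i < Suc r" for i
      using that mem(2) cmult_mem[OF eV, of "1 / s"] by (auto simp: \<psi>_def less_Suc_eq)
    have \<psi>_span: "\<psi> i \<in> fspan (Suc n) z" if "i < Suc r" for i
      using that mem' fspan_cmult[OF e_span, of "1 / s"] by (auto simp: \<psi>_def less_Suc_eq)
    have \<psi>_eq: "\<psi> i = \<phi> i" if "i < r" for i using that by (simp add: \<psi>_def)
    have e\<psi>: "(\<lambda>x. 1 / s * e x) \<in> V" by (intro cmult_mem eV)
    have rr: "B (\<psi> r) (\<psi> r) = 1"
    proof -
      have "B (\<psi> r) (\<psi> r) = 1 / s * B e (\<lambda>x. 1 / s * e x)"
        unfolding \<psi>_def using cmult_left[OF eV e\<psi>, of "1 / s"] by simp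
      also have "B e (\<lambda>x. 1 / s * e x) = 1 / s * B e e"
        using sym[OF eV e\<psi>] cmult_left[OF eV eV, of "1 / s"] by simp
      finally show ?thesis using s pos by (simp add: field_simps)
    qed
    have ri: "B (\<psi> r) (\<psi> i) = 0" "B (\<psi> i) (\<psi> r) = 0" if i: "i < r" for i
    proof -
      show "B (\<psi> r) (\<psi> i) = 0"
        using cmult_left[OF eV mem(2)[OF i], of "1 / s"] e_orth[OF i] i by (simp add: \<psi>_def)
      then show "B (\<psi> i) (\<psi> r) = 0"
        using sym[OF \<psi>V \<psi>V, of i r] i by simp
    qed
    have orth': "B (\<psi> i) (\<psi> j) = (if i = j then 1 else 0)" if "i < Suc r" "j < Suc r" for i j
      using that rr ri orth[of i j] by (auto simp: less_Suc_eq \<psi>_eq)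
    have span': "\<exists>a. B (?res (Suc r) \<psi> j a) (?res (Suc r) \<psi> j a) = 0" if j: "j < Suc n" for j
    proof (cases "j = n")
      case True
      define a where "a i = (if i = r then s else b i)" for i
      have "?res (Suc r) \<psi> j a = (\<lambda>x. 0)"
        using s True by (auto simp: a_def \<psi>_def e_def)
      then have "B (?res (Suc r) \<psi> j a) (?res (Suc r) \<psi> j a) = 0"
        using zero_left[OF zero_mem] by simp
      then show ?thesis by blast
    next
      case False
      with j have "j < n" by simp
      from span[OF this] obtain a where a: "B (?res r \<phi> j a) (?res r \<phi> j a) = 0" ..
      define a' where "a' i = (if i = r then 0 else a i)" for i
      have "?res (Suc r) \<psi> j a' = ?res r \<phi> j a"
        by (auto simp: a'_def \<psi>_def)
      with a have "B (?res (Suc r) \<psi> j a') (?res (Suc r) \<psi> j a') = 0" by simp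
      then show ?thesis by blast
    qed
    have indep': "Suc r = Suc n" if H: "nondegenerate (Suc n) z"
    proof -
      have "r = n"
      proof (rule indep, unfold nondegenerate_def, intro allI impI)
        fix c i assume c: "B (\<lambda>x. \<Sum>i<n. c i * z i x) (\<lambda>x. \<Sum>i<n. c i * z i x) = 0" and i: "i < n"
        define c' where "c' i = (if i = n then 0 else c i)" for i
        have "(\<lambda>x. \<Sum>i<Suc n. c' i * z i x) = (\<lambda>x. \<Sum>i<n. c i * z i x)"
          by (auto simp: c'_def)
        then have "B (\<lambda>x. \<Sum>i<Suc n. c' i * z i x) (\<lambda>x. \<Sum>i<Suc n. c' i * z i x) = 0"
          using c by (simp only:)
        with H have "\<forall>i<Suc n. c' i = 0"
          unfolding nondegenerate_def by simp
        then have "c' i = 0" using i by simp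
        with i show "c i = 0" by (simp add: c'_def)
      qed
      then show ?thesis by simp
    qed
    have "spans_orthonormally (Suc n) z (Suc r) \<psi>"
      using r \<psi>V \<psi>_span orth' span' unfolding spans_orthonormally_def by simp
    with indep' show ?thesis by blast
  qed
qed

end

section \<open>Lewis change of density\<close>

text \<open>An orthonormal basis of the span in the space of functions on \<open>S\<close> weighted
  by \<open>q\<close>. The expansion is asked for on \<open>S\<close> only, since the weighted sums
  do not see other points.\<close>

definition orthonormal_expansion ::
    "'b set \<Rightarrow> ('b \<Rightarrow> real) \<Rightarrow> nat \<Rightarrow> (nat \<Rightarrow> 'b \<Rightarrow> real) \<Rightarrow> nat \<Rightarrow> (nat \<Rightarrow> 'b \<Rightarrow> real) \<Rightarrow> bool" where
  "orthonormal_expansion S q n z r \<phi> \<longleftrightarrow> r \<le> n \<and> (\<forall>i<r. \<phi> i \<in> fspan n z)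
    \<and> (\<forall>i<r. \<forall>j<r. (\<Sum>t\<in>S. q t * (\<phi> i t * \<phi> j t)) = (if i = j then 1 else 0))
    \<and> (\<forall>h\<in>fspan n z. \<forall>s\<in>S. h s = (\<Sum>i<r. (\<Sum>t\<in>S. q t * (h t * \<phi> i t)) * \<phi> i s))"

text \<open>The diagonal of the reproducing kernel, that is, the reciprocal of the classical
  Christoffel function.\<close>

definition christoffel :: "nat \<Rightarrow> (nat \<Rightarrow> 'b \<Rightarrow> real) \<Rightarrow> 'b \<Rightarrow> real" where
  "christoffel r \<phi> s = (\<Sum>i<r. (\<phi> i s)\<^sup>2)"

lemma christoffel_nonneg: "0 \<le> christoffel r \<phi> s"
  by (simp add: christoffel_def sum_nonneg)

text \<open>All weights are positive, so a residual of square zero vanishes at every point of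
  \<open>S\<close> and the Gram-Schmidt expansion is exact there.\<close>

lemma orthonormal_expansion_exists:
  assumes S: "finite S" and q: "\<And>s. s \<in> S \<Longrightarrow> 0 < q s"
  shows "\<exists>r \<phi>. orthonormal_expansion S q n z r \<phi>"
proof -
  let ?B = "\<lambda>f g. \<Sum>t\<in>S. q t * (f t * g t)"
  interpret semi_inner_product UNIV ?B
  proof unfold_locales
    show "?B (\<lambda>x. f x + g x) h = ?B f h + ?B g h" for f g h
      by (simp add: distrib_left distrib_right sum.distrib)
    show "?B (\<lambda>x. c * f x) h = c * ?B f h" for c f h
      by (simp add: sum_distrib_left ac_simps)
    show "0 \<le> ?B f f" for f
      by (intro sum_nonneg mult_nonneg_nonneg[OF less_imp_le[OF q] zero_le_square])
  qed (simp_all add: mult.commute)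
  obtain r \<phi> where rz: "spans_orthonormally n z r \<phi>"
    using gram_schmidt[of n z, OF UNIV_I] by blast
  note orth = spans_orthonormallyD(4)[OF rz]
  obtain a where a: "?B (\<lambda>x. z j x - (\<Sum>i<r. a j i * \<phi> i x)) (\<lambda>x. z j x - (\<Sum>i<r. a j i * \<phi> i x)) = 0"
    if "j < n" for j
    using spans_orthonormallyD(5)[OF rz] by blast
  have z: "z j s = (\<Sum>i<r. a j i * \<phi> i s)" if j: "j < n" and s: "s \<in> S" for j s
  proof -
    have "q s * ((z j s - (\<Sum>i<r. a j i * \<phi> i s)) * (z j s - (\<Sum>i<r. a j i * \<phi> i s))) = 0"
      using a[OF j] s q
      by (subst (asm) sum_nonneg_eq_0_iff[OF S]) (auto intro!: mult_nonneg_nonneg simp: less_imp_le)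
    then show ?thesis using q[OF s] by auto
  qed
  have "h s = (\<Sum>i<r. ?B h (\<phi> i) * \<phi> i s)" if h: "h \<in> fspan n z" and s: "s \<in> S" for h s
  proof -
    obtain c where c: "h = (\<lambda>x. \<Sum>j<n. c j * z j x)" using h by (auto simp: fspan_def)
    define b where "b i = (\<Sum>j<n. c j * a j i)" for i
    have hb: "h x = (\<Sum>i<r. b i * \<phi> i x)" if "x \<in> S" for x
    proof -
      have "h x = (\<Sum>j<n. c j * (\<Sum>i<r. a j i * \<phi> i x))"
        unfolding c by (intro sum.cong) (auto simp: z that)
      also have "\<dots> = (\<Sum>i<r. \<Sum>j<n. c j * (a j i * \<phi> i x))"
        by (simp only: sum_distrib_left) (rule sum.swap)
      finally show ?thesis by (simp add: b_def sum_distrib_right mult.assoc)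
    qed
    have "?B h (\<phi> i) = b i" if i: "i < r" for i
    proof -
      have "?B h (\<phi> i) = ?B (\<lambda>x. \<Sum>k<r. b k * \<phi> k x) (\<phi> i)"
        by (intro sum.cong) (auto simp: hb)
      also have "\<dots> = (\<Sum>k<r. b k * ?B (\<phi> k) (\<phi> i))"
        by (rule sum_cmult_left) auto
      also have "\<dots> = (\<Sum>k<r. if k = i then b i else 0)"
        by (intro sum.cong) (auto simp: orth i)
      finally show ?thesis using i by simp
    qed
    then show ?thesis using hb[OF s] by simp
  qed
  then show ?thesis
    using spans_orthonormallyD(1,2,4)[OF rz] unfolding orthonormal_expansion_def by blast
qed

section \<open>Parseval identity, extremal property and trace of the kernel diagonal\<close>

context
  fixes S :: "'b set" and q n z r and \<phi> :: "nat \<Rightarrow> 'b \<Rightarrow> real"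
  assumes onb: "orthonormal_expansion S q n z r \<phi>"
begin

lemma onb_expand:
  "h \<in> fspan n z \<Longrightarrow> s \<in> S \<Longrightarrow> h s = (\<Sum>i<r. (\<Sum>t\<in>S. q t * (h t * \<phi> i t)) * \<phi> i s)"
  using onb unfolding orthonormal_expansion_def by blast

lemma onb_norm: "(\<Sum>t\<in>S. q t * (\<Sum>i<r. b i * \<phi> i t)\<^sup>2) = (\<Sum>i<r. (b i)\<^sup>2)"
proof -
  have "(\<Sum>t\<in>S. q t * (\<Sum>i<r. b i * \<phi> i t)\<^sup>2)
      = (\<Sum>t\<in>S. \<Sum>i<r. \<Sum>j<r. b i * (b j * (q t * (\<phi> i t * \<phi> j t))))"
    by (simp add: power2_eq_square sum_product sum_distrib_left ac_simps)
  also have "\<dots> = (\<Sum>i<r. \<Sum>t\<in>S. \<Sum>j<r. b i * (b j * (q t * (\<phi> i t * \<phi> j t))))"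
    by (rule sum.swap)
  also have "\<dots> = (\<Sum>i<r. \<Sum>j<r. \<Sum>t\<in>S. b i * (b j * (q t * (\<phi> i t * \<phi> j t))))"
    by (intro sum.cong refl sum.swap)
  also have "\<dots> = (\<Sum>i<r. \<Sum>j<r. b i * (b j * (\<Sum>t\<in>S. q t * (\<phi> i t * \<phi> j t))))"
    by (simp add: sum_distrib_left)
  also have "\<dots> = (\<Sum>i<r. \<Sum>j<r. if j = i then b i * b i else 0)"
    using onb unfolding orthonormal_expansion_def by (intro sum.cong) auto
  finally show ?thesis by (simp add: power2_eq_square)
qed

text \<open>Cauchy-Schwarz for the expansion of \<open>h\<close> at \<open>s\<close>, combined with
  Parseval for its coefficients.\<close>

lemma onb_extremal:
  assumes h: "h \<in> fspan n z" and s: "s \<in> S"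
  shows "(h s)\<^sup>2 \<le> (\<Sum>t\<in>S. q t * (h t)\<^sup>2) * christoffel r \<phi> s"
proof -
  define b where "b i = (\<Sum>t\<in>S. q t * (h t * \<phi> i t))" for i
  have hb: "h x = (\<Sum>i<r. b i * \<phi> i x)" if "x \<in> S" for x
    unfolding b_def by (rule onb_expand[OF h that])
  have "(\<Sum>t\<in>S. q t * (h t)\<^sup>2) = (\<Sum>i<r. (b i)\<^sup>2)"
    unfolding onb_norm[symmetric] by (intro sum.cong) (auto simp: hb)
  then show ?thesis
    using Cauchy_Schwarz_ineq_sum[of b "\<lambda>i. \<phi> i s" "{..<r}"] hb[OF s]
    by (simp add: christoffel_def)
qed

text \<open>The trace of the orthogonal projection is its rank. This is how the dimension enters the
  sampling bound.\<close>

lemma sum_christoffel: "(\<Sum>t\<in>S. q t * christoffel r \<phi> t) = real r"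
proof -
  have "(\<Sum>t\<in>S. q t * christoffel r \<phi> t) = (\<Sum>t\<in>S. \<Sum>i<r. q t * (\<phi> i t * \<phi> i t))"
    by (simp add: christoffel_def power2_eq_square sum_distrib_left)
  also have "\<dots> = (\<Sum>i<r. \<Sum>t\<in>S. q t * (\<phi> i t * \<phi> i t))" by (rule sum.swap)
  also have "\<dots> = (\<Sum>i<r. 1)"
    using onb unfolding orthonormal_expansion_def by (intro sum.cong) auto
  finally show ?thesis by simp
qed

lemma christoffel_pos:
  assumes s: "s \<in> S" and nz: "i < n" "z i s \<noteq> 0"
  shows "0 < christoffel r \<phi> s"
proof -
  have "0 < (z i s)\<^sup>2" using nz by simp
  also have "\<dots> \<le> (\<Sum>t\<in>S. q t * (z i t)\<^sup>2) * christoffel r \<phi> s"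
    by (intro onb_extremal fspan_base nz s)
  finally show ?thesis
    using christoffel_nonneg[of r \<phi> s] by (cases "christoffel r \<phi> s = 0") auto
qed

end

text \<open>The kernel section \<open>h\<close> at \<open>s\<close> is extremal for the weight
  \<open>q\<close>: both its value at \<open>s\<close> and its squared norm are the kernel diagonal
  there. Testing it in the extremal inequality for \<open>q'\<close> gives the comparison.\<close>

lemma christoffel_compare:
  assumes 1: "orthonormal_expansion S q n z r \<phi>" and 2: "orthonormal_expansion S q' n z r' \<phi>'"
    and le: "\<And>t. t \<in> S \<Longrightarrow> q' t \<le> \<alpha> * q t" and "0 \<le> \<alpha>" and s: "s \<in> S"
  shows "christoffel r \<phi> s \<le> \<alpha> * christoffel r' \<phi>' s"
proof (cases "christoffel r \<phi> s = 0")
  case True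
  then show ?thesis using \<open>0 \<le> \<alpha>\<close> christoffel_nonneg[of r' \<phi>' s] by simp
next
  case False
  let ?G = "christoffel r \<phi> s"
  have pos: "0 < ?G" using False christoffel_nonneg[of r \<phi> s] by simp
  define h where "h x = (\<Sum>i<r. \<phi> i s * \<phi> i x)" for x
  have mem: "h \<in> fspan n z"
    using 1 unfolding h_def orthonormal_expansion_def by (intro fspan_sum_cmult) auto
  have hs: "h s = ?G" by (simp add: h_def christoffel_def power2_eq_square)
  have "?G\<^sup>2 \<le> (\<Sum>t\<in>S. q' t * (h t)\<^sup>2) * christoffel r' \<phi>' s"
    using onb_extremal[OF 2 mem s] hs by simp
  also have "\<dots> \<le> (\<Sum>t\<in>S. \<alpha> * q t * (h t)\<^sup>2) * christoffel r' \<phi>' s"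
    by (intro mult_right_mono sum_mono le christoffel_nonneg) auto
  also have "(\<Sum>t\<in>S. \<alpha> * q t * (h t)\<^sup>2) = \<alpha> * ?G"
    using onb_norm[OF 1, of "\<lambda>i. \<phi> i s"]
    by (simp add: h_def christoffel_def mult.assoc flip: sum_distrib_left)
  finally have "?G * ?G \<le> ?G * (\<alpha> * christoffel r' \<phi>' s)"
    by (simp add: power2_eq_square ac_simps)
  then show ?thesis using pos by simp
qed

text \<open>For \<open>b = 1\<close> this is the Lewis change of density, a fixed point of
  \<open>\<rho> \<mapsto> sqrt \<Gamma>\<^sub>\<rho>\<close> with \<open>\<Gamma>\<^sub>\<rho>\<close> the Christoffel function of the weight \<open>w / \<rho>\<close>. Replacing \<open>\<rho>\<close> by
  \<open>c \<rho>\<close> changes \<open>\<Gamma>\<^sub>\<rho>\<close> by the factor \<open>c\<close>, so this map halves logarithmic distances and iterating it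
  brings \<open>b\<close> down to 2.\<close>

definition nearly_lewis ::
    "'b set \<Rightarrow> ('b \<Rightarrow> real) \<Rightarrow> nat \<Rightarrow> (nat \<Rightarrow> 'b \<Rightarrow> real) \<Rightarrow> real \<Rightarrow> ('b \<Rightarrow> real) \<Rightarrow> nat \<Rightarrow> (nat \<Rightarrow> 'b \<Rightarrow> real) \<Rightarrow> bool" where
  "nearly_lewis S w n z b \<rho> r \<phi> \<longleftrightarrow> (\<forall>s\<in>S. 0 < \<rho> s)
    \<and> orthonormal_expansion S (\<lambda>s. w s / \<rho> s) n z r \<phi>
    \<and> (\<forall>s\<in>S. christoffel r \<phi> s \<le> b * (\<rho> s)\<^sup>2 \<and> (\<rho> s)\<^sup>2 \<le> b * christoffel r \<phi> s)"

text \<open>The new density is the square root of the old kernel diagonal. By hypothesis the two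
  densities agree up to the factor \<open>sqrt b\<close>, hence so do the two weights and the two
  kernel diagonals; and the old diagonal is exactly the square of the new density.\<close>

lemma nearly_lewis_improve:
  assumes S: "finite S" and w: "\<And>s. s \<in> S \<Longrightarrow> 0 < w s"
    and nz: "\<And>s. s \<in> S \<Longrightarrow> \<exists>i<n. z i s \<noteq> 0"
    and b: "0 \<le> b" and L: "nearly_lewis S w n z b \<rho> r \<phi>"
  shows "\<exists>\<rho>' r' \<phi>'. nearly_lewis S w n z (sqrt b) \<rho>' r' \<phi>'"
proof -
  have \<rho>: "\<And>s. s \<in> S \<Longrightarrow> 0 < \<rho> s" and onb: "orthonormal_expansion S (\<lambda>s. w s / \<rho> s) n z r \<phi>"
    and le: "\<And>s. s \<in> S \<Longrightarrow> christoffel r \<phi> s \<le> b * (\<rho> s)\<^sup>2"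
      "\<And>s. s \<in> S \<Longrightarrow> (\<rho> s)\<^sup>2 \<le> b * christoffel r \<phi> s"
    using L unfolding nearly_lewis_def by auto
  define \<rho>' where "\<rho>' s = sqrt (christoffel r \<phi> s)" for s
  have \<rho>': "0 < \<rho>' s" if "s \<in> S" for s
    using christoffel_pos[OF onb that] nz[OF that] by (auto simp: \<rho>'_def)
  have sq: "(\<rho>' s)\<^sup>2 = christoffel r \<phi> s" for s
    by (simp add: \<rho>'_def christoffel_nonneg)
  have le': "\<rho>' s \<le> sqrt b * \<rho> s" "\<rho> s \<le> sqrt b * \<rho>' s" if "s \<in> S" for s
  proof -
    show "\<rho>' s \<le> sqrt b * \<rho> s"
    proof (rule power2_le_imp_le)
      show "(\<rho>' s)\<^sup>2 \<le> (sqrt b * \<rho> s)\<^sup>2"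
        using le(1)[OF that] b by (simp add: sq power_mult_distrib)
    qed (use b \<rho>[OF that] in simp)
    show "\<rho> s \<le> sqrt b * \<rho>' s"
    proof (rule power2_le_imp_le)
      show "(\<rho> s)\<^sup>2 \<le> (sqrt b * \<rho>' s)\<^sup>2"
        using le(2)[OF that] b by (simp add: sq power_mult_distrib)
    qed (use b \<rho>'[OF that] in simp)
  qed
  have "0 < w s / \<rho>' s" if "s \<in> S" for s using w \<rho>' that by simp
  from orthonormal_expansion_exists[of S "\<lambda>s. w s / \<rho>' s" n z, OF S this] obtain r' \<phi>'
    where onb': "orthonormal_expansion S (\<lambda>s. w s / \<rho>' s) n z r' \<phi>'" by blast
  have "christoffel r' \<phi>' s \<le> sqrt b * (\<rho>' s)\<^sup>2" if "s \<in> S" for s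
    unfolding sq
  proof (rule christoffel_compare[OF onb' onb _ _ that])
    fix t assume t: "t \<in> S"
    have "w t * \<rho>' t \<le> w t * (sqrt b * \<rho> t)"
      using le'(1)[OF t] w[OF t] by (intro mult_left_mono) auto
    then show "w t / \<rho> t \<le> sqrt b * (w t / \<rho>' t)"
      using \<rho>[OF t] \<rho>'[OF t] by (simp add: field_simps)
  qed (use b in auto)
  moreover have "(\<rho>' s)\<^sup>2 \<le> sqrt b * christoffel r' \<phi>' s" if "s \<in> S" for s
    unfolding sq
  proof (rule christoffel_compare[OF onb onb' _ _ that])
    fix t assume t: "t \<in> S"
    have "w t * \<rho> t \<le> w t * (sqrt b * \<rho>' t)"
      using le'(2)[OF t] w[OF t] by (intro mult_left_mono) auto
    then show "w t / \<rho>' t \<le> sqrt b * (w t / \<rho> t)"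
      using \<rho>[OF t] \<rho>'[OF t] by (simp add: field_simps)
  qed (use b in auto)
  ultimately show ?thesis
    using \<rho>' onb' unfolding nearly_lewis_def by blast
qed

text \<open>Starting from the density 1 with some finite \<open>b\<close>, each improvement takes a
  square root of \<open>b\<close>, so finitely many steps reach 2 and no limit or fixed point is
  needed.\<close>

lemma nearly_lewis_exists:
  assumes S: "finite S" and w: "\<And>s. s \<in> S \<Longrightarrow> 0 < w s"
    and nz: "\<And>s. s \<in> S \<Longrightarrow> \<exists>i<n. z i s \<noteq> 0"
  shows "\<exists>\<rho> r \<phi>. nearly_lewis S w n z 2 \<rho> r \<phi>"
proof -
  have iterate: "\<exists>\<rho> r \<phi>. nearly_lewis S w n z 2 \<rho> r \<phi>"
    if "nearly_lewis S w n z b \<rho> r \<phi>" "0 \<le> b" "b \<le> 2 ^ 2 ^ k" for b \<rho> r \<phi> and k :: nat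
    using that
  proof (induction k arbitrary: b \<rho> r \<phi>)
    case 0
    have "nearly_lewis S w n z 2 \<rho> r \<phi>"
      unfolding nearly_lewis_def
    proof (intro conjI ballI)
      fix s assume s: "s \<in> S"
      have "b * (\<rho> s)\<^sup>2 \<le> 2 * (\<rho> s)\<^sup>2" "b * christoffel r \<phi> s \<le> 2 * christoffel r \<phi> s"
        using 0 christoffel_nonneg[of r \<phi> s] by (auto intro!: mult_right_mono)
      moreover have "christoffel r \<phi> s \<le> b * (\<rho> s)\<^sup>2" "(\<rho> s)\<^sup>2 \<le> b * christoffel r \<phi> s"
        using 0(1) s unfolding nearly_lewis_def by auto
      ultimately show "christoffel r \<phi> s \<le> 2 * (\<rho> s)\<^sup>2" "(\<rho> s)\<^sup>2 \<le> 2 * christoffel r \<phi> s"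
        by linarith+
    qed (use 0(1) in \<open>auto simp: nearly_lewis_def\<close>)
    then show ?case by blast
  next
    case (Suc k)
    from nearly_lewis_improve[OF S w nz Suc.prems(2,1)] obtain \<rho>' r' \<phi>'
      where "nearly_lewis S w n z (sqrt b) \<rho>' r' \<phi>'" by blast
    moreover have "sqrt b \<le> 2 ^ 2 ^ k"
    proof (rule real_le_lsqrt)
      have "(2::real) ^ 2 ^ Suc k = (2 ^ 2 ^ k)\<^sup>2"
        by (simp only: power_mult[symmetric] power_Suc2)
      with Suc.prems(3) show "b \<le> (2 ^ 2 ^ k)\<^sup>2" by (simp only:)
    qed simp
    ultimately show ?case using Suc.IH[of "sqrt b"] Suc.prems(2) by simp
  qed
  have "0 < w s / 1" if "s \<in> S" for s using w that by simp
  from orthonormal_expansion_exists[of S "\<lambda>s. w s / 1" n z, OF S this] obtain r \<phi>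
    where onb: "orthonormal_expansion S (\<lambda>s. w s / 1) n z r \<phi>" by blast
  let ?G = "christoffel r \<phi>"
  have pos: "0 < ?G s" if "s \<in> S" for s
    using christoffel_pos[OF onb that] nz[OF that] by auto
  \<comment> \<open>This sum dominates both the kernel diagonal and its reciprocal at every point of
    the finite set \<open>S\<close>.\<close>
  define b where "b = (\<Sum>s\<in>S. ?G s + 1 / ?G s)"
  have b: "?G s + 1 / ?G s \<le> b" if "s \<in> S" for s
    unfolding b_def using pos that by (intro member_le_sum S) (auto intro!: less_imp_le add_pos_pos divide_pos_pos)
  have "nearly_lewis S w n z b (\<lambda>_. 1) r \<phi>"
    unfolding nearly_lewis_def
  proof (intro conjI ballI)
    fix s assume s: "s \<in> S"
    have "0 < 1 / ?G s" using pos[OF s] by simp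
    then have "?G s \<le> b" "1 / ?G s \<le> b" using b[OF s] pos[OF s] by linarith+
    then show "?G s \<le> b * 1\<^sup>2" "1\<^sup>2 \<le> b * ?G s"
      using pos[OF s] by (auto simp: field_simps)
  qed (use onb in auto)
  moreover have "0 \<le> b"
    unfolding b_def by (intro sum_nonneg) (auto intro!: less_imp_le add_pos_pos divide_pos_pos pos)
  moreover obtain k where "b \<le> 2 ^ 2 ^ k"
  proof -
    obtain j :: nat where "b < 2 ^ j" using real_arch_pow[of 2 b] by auto
    also have "(2::real) ^ j \<le> 2 ^ 2 ^ j" by (rule power_increasing[OF less_imp_le[OF less_exp]]) simp
    finally have "b \<le> 2 ^ 2 ^ j" by simp
    then show ?thesis by (rule that)
  qed
  ultimately show ?thesis using iterate by blast
qed

text \<open>Points are drawn with probability \<open>p\<close> proportional to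
  \<open>w * \<rho>\<close>, and \<open>h\<close> is replaced by
  \<open>\<tau> h = I * h / \<rho>\<close>, which preserves the L1 norm. The near-Lewis property
  bounds the kernel of the transformed space by \<open>2 * I\<close>, and the trace identity gives
  \<open>2 * I \<le> 4 * n\<close>. The condition on \<open>m\<close> is the earlier one with
  \<open>D = 4 * n\<close>.\<close>

lemma finite_L1_sampling:
  assumes S: "finite S" "S \<noteq> {}" and w: "\<And>s. s \<in> S \<Longrightarrow> 0 < w s"
    and nz: "\<And>s. s \<in> S \<Longrightarrow> \<exists>i<n. z i s \<noteq> 0"
    and m: "1024 * real n * (ln (4 * real n) + 2) \<le> real m"
  shows "\<exists>xs c. set xs \<subseteq> S \<and> length xs = m \<and> (\<forall>s\<in>S. 0 \<le> c s) \<and>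
    (\<forall>h\<in>fspan n z. \<bar>(\<Sum>s\<in>S. w s * \<bar>h s\<bar>) - (\<Sum>x\<leftarrow>xs. c x * \<bar>h x\<bar>)\<bar> \<le> (\<Sum>s\<in>S. w s * \<bar>h s\<bar>) / 2)"
proof -
  have n: "1 \<le> n" using S(2) nz by fastforce
  obtain \<rho> r \<phi> where L: "nearly_lewis S w n z 2 \<rho> r \<phi>"
    using nearly_lewis_exists[of S w n z, OF S(1) w nz] by blast
  then have \<rho>: "\<And>s. s \<in> S \<Longrightarrow> 0 < \<rho> s" and onb: "orthonormal_expansion S (\<lambda>s. w s / \<rho> s) n z r \<phi>"
    and le: "\<And>s. s \<in> S \<Longrightarrow> christoffel r \<phi> s \<le> 2 * (\<rho> s)\<^sup>2"
      "\<And>s. s \<in> S \<Longrightarrow> (\<rho> s)\<^sup>2 \<le> 2 * christoffel r \<phi> s"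
    unfolding nearly_lewis_def by auto
  let ?G = "christoffel r \<phi>"
  define I where "I = (\<Sum>s\<in>S. w s * \<rho> s)"
  have I: "0 < I" unfolding I_def using S w \<rho> by (intro sum_pos) auto
  have I2: "2 * I \<le> 4 * real n"
  proof -
    have "I \<le> (\<Sum>s\<in>S. 2 * (w s / \<rho> s * ?G s))"
      unfolding I_def
    proof (rule sum_mono)
      fix s assume s: "s \<in> S"
      have "w s * \<rho> s = w s / \<rho> s * (\<rho> s)\<^sup>2"
        using \<rho>[OF s] by (simp add: power2_eq_square)
      also have "\<dots> \<le> w s / \<rho> s * (2 * ?G s)"
        using le(2)[OF s] w[OF s] \<rho>[OF s] by (intro mult_left_mono) auto
      finally show "w s * \<rho> s \<le> 2 * (w s / \<rho> s * ?G s)" by (simp only: mult.left_commute)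
    qed
    also have "\<dots> = 2 * real r"
      by (simp only: sum_distrib_left[symmetric] sum_christoffel[OF onb])
    finally show ?thesis using onb unfolding orthonormal_expansion_def by simp
  qed
  define p where "p s = w s * \<rho> s / I" for s
  define k where "k x y = (\<Sum>i<r. \<phi> i x * \<phi> i y)" for x y
  define K where "K x y = I * k x y / (\<rho> x * \<rho> y)" for x y
  define norm1 where "norm1 h = (\<Sum>s\<in>S. w s * \<bar>h s\<bar>)" for h
  define \<tau> where "\<tau> h = (\<lambda>x. I * h x / \<rho> x)" for h :: "'a \<Rightarrow> real"
  define T where "T = {\<tau> h | h. h \<in> fspan n z \<and> norm1 h \<le> 1}"
  have norm_\<tau>: "(\<Sum>s\<in>S. p s * \<bar>\<tau> h s\<bar>) = norm1 h" for h
    unfolding norm1_def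
    by (intro sum.cong) (use I in \<open>auto simp: p_def \<tau>_def abs_mult dest: \<rho>\<close>)
  have p: "0 \<le> p s" if "s \<in> S" for s
    using w[OF that] \<rho>[OF that] I by (simp add: p_def)
  have p1: "sum p S = 1"
    using I by (simp add: p_def I_def flip: sum_divide_distrib)
  have K: "\<bar>K x y\<bar> \<le> 4 * real n" if x: "x \<in> S" and y: "y \<in> S" for x y
  proof -
    have "(k x y)\<^sup>2 \<le> ?G x * ?G y"
      unfolding k_def christoffel_def by (rule Cauchy_Schwarz_ineq_sum)
    also have "\<dots> \<le> (2 * (\<rho> x)\<^sup>2) * (2 * (\<rho> y)\<^sup>2)"
      by (intro mult_mono le x y christoffel_nonneg) auto
    also have "\<dots> = (2 * \<rho> x * \<rho> y)\<^sup>2" by (simp add: power_mult_distrib)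
    finally have "\<bar>k x y\<bar> \<le> 2 * \<rho> x * \<rho> y"
      using \<rho>[OF x] \<rho>[OF y] by (simp add: abs_le_square_iff[symmetric])
    then have "I * (\<bar>k x y\<bar> / (\<rho> x * \<rho> y)) \<le> I * 2"
      using I \<rho>[OF x] \<rho>[OF y] by (intro mult_left_mono) (auto simp: field_simps)
    then show ?thesis
      using I2 I \<rho>[OF x] \<rho>[OF y] by (simp add: K_def abs_mult)
  qed
  have K2: "(\<Sum>x\<in>S. p x * (K x y)\<^sup>2) \<le> 4 * real n" if y: "y \<in> S" for y
  proof -
    have "(\<Sum>x\<in>S. p x * (K x y)\<^sup>2) = (\<Sum>x\<in>S. I / (\<rho> y)\<^sup>2 * (w x / \<rho> x * (\<Sum>i<r. \<phi> i y * \<phi> i x)\<^sup>2))"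
    proof (rule sum.cong)
      fix x assume x: "x \<in> S"
      show "p x * (K x y)\<^sup>2 = I / (\<rho> y)\<^sup>2 * (w x / \<rho> x * (\<Sum>i<r. \<phi> i y * \<phi> i x)\<^sup>2)"
        using I \<rho>[OF x] \<rho>[OF y]
        by (simp add: p_def K_def k_def power_mult_distrib power_divide mult.commute[of "\<phi> _ y"])
          (simp add: power2_eq_square field_simps)
    qed simp
    also have "\<dots> = I / (\<rho> y)\<^sup>2 * ?G y"
      by (simp only: sum_distrib_left[symmetric] onb_norm[OF onb] christoffel_def)
    also have "\<dots> \<le> I / (\<rho> y)\<^sup>2 * (2 * (\<rho> y)\<^sup>2)"
      using I le(1)[OF y] by (intro mult_left_mono) auto
    also have "\<dots> \<le> 4 * real n" using I2 \<rho>[OF y] by simp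
    finally show ?thesis .
  qed
  have rep: "t x = (\<Sum>y\<in>S. p y * (K x y * t y))" if t: "t \<in> T" and x: "x \<in> S" for t x
  proof -
    obtain h where h: "h \<in> fspan n z" "t = \<tau> h" using t by (auto simp: T_def)
    have "(\<Sum>y\<in>S. p y * (K x y * t y))
      = (\<Sum>y\<in>S. \<Sum>i<r. I / \<rho> x * (w y / \<rho> y * (h y * \<phi> i y) * \<phi> i x))"
    proof (rule sum.cong)
      fix y assume y: "y \<in> S"
      have "p y * (K x y * t y) = I / \<rho> x * (w y / \<rho> y * h y * k x y)"
        using I \<rho>[OF x] \<rho>[OF y] by (simp add: p_def K_def h(2) \<tau>_def)
      then show "p y * (K x y * t y) = (\<Sum>i<r. I / \<rho> x * (w y / \<rho> y * (h y * \<phi> i y) * \<phi> i x))"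
        by (simp add: k_def sum_distrib_left ac_simps)
    qed simp
    also have "\<dots> = (\<Sum>i<r. \<Sum>y\<in>S. I / \<rho> x * (w y / \<rho> y * (h y * \<phi> i y) * \<phi> i x))"
      by (rule sum.swap)
    also have "\<dots> = I / \<rho> x * (\<Sum>i<r. (\<Sum>y\<in>S. w y / \<rho> y * (h y * \<phi> i y)) * \<phi> i x)"
      by (simp only: sum_distrib_left sum_distrib_right)
    also have "(\<Sum>i<r. (\<Sum>y\<in>S. w y / \<rho> y * (h y * \<phi> i y)) * \<phi> i x) = h x"
      by (rule onb_expand[OF onb h(1) x, symmetric])
    finally show ?thesis by (simp add: h(2) \<tau>_def)
  qed
  have T0: "(\<lambda>x. 0) \<in> T"
    unfolding T_def using fspan_zero[of n z]
    by (intro CollectI exI[of _ "\<lambda>x. 0"]) (auto simp: \<tau>_def norm1_def)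
  have T1: "(\<Sum>y\<in>S. p y * \<bar>t y\<bar>) \<le> 1" if "t \<in> T" for t
    using that norm_\<tau> by (auto simp: T_def)
  have "\<exists>xs. set xs \<subseteq> S \<and> length xs = m \<and>
    (\<forall>t\<in>T. \<bar>real m * (\<Sum>y\<in>S. p y * \<bar>t y\<bar>) - (\<Sum>x\<leftarrow>xs. \<bar>t x\<bar>)\<bar> \<le> real m / 2)"
    by (rule sampling_absolute_means[where D = "4 * real n" and K = K, OF S(1) p p1])
      (use n m K K2 T0 rep T1 in \<open>auto simp: ac_simps\<close>)
  then obtain xs where xs: "set xs \<subseteq> S" "length xs = m"
    and close: "\<And>t. t \<in> T \<Longrightarrow> \<bar>real m * (\<Sum>y\<in>S. p y * \<bar>t y\<bar>) - (\<Sum>x\<leftarrow>xs. \<bar>t x\<bar>)\<bar> \<le> real m / 2"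
    by blast
  have mpos: "0 < real m"
  proof -
    have "0 < 1024 * real n * (ln (4 * real n) + 2)"
      using n by (intro mult_pos_pos add_nonneg_pos ln_ge_zero) auto
    with m show ?thesis by linarith
  qed
  define c where "c x = I / (real m * \<rho> x)" for x
  have sum_\<tau>: "(\<Sum>x\<leftarrow>ys. \<bar>\<tau> h x\<bar>) = real m * (\<Sum>x\<leftarrow>ys. c x * \<bar>h x\<bar>)" if "set ys \<subseteq> S" for h ys
    using that by (induction ys) (use I mpos in \<open>auto simp: \<tau>_def c_def abs_mult distrib_left dest!: \<rho>\<close>)
  have "\<bar>norm1 h - (\<Sum>x\<leftarrow>xs. c x * \<bar>h x\<bar>)\<bar> \<le> norm1 h / 2" if h: "h \<in> fspan n z" for h
  \<comment> \<open>\<open>T\<close> comes from the unit ball, so \<open>h\<close> has to be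
    normalized. If its norm is zero, positivity of \<open>w\<close> forces \<open>h\<close> to
    vanish on \<open>S\<close> and both sides are zero.\<close>
  proof (cases "norm1 h = 0")
    case True
    then have h0: "h s = 0" if "s \<in> S" for s
      using that w unfolding norm1_def
      by (subst (asm) sum_nonneg_eq_0_iff[OF S(1)]) (fastforce intro!: mult_nonneg_nonneg simp: less_imp_le)+
    have "(\<Sum>x\<leftarrow>ys. c x * \<bar>h x\<bar>) = 0" if "set ys \<subseteq> S" for ys
      using that by (induction ys) (auto simp: h0)
    from this[OF xs(1)] True show ?thesis by simp
  next
    case False
    then have v: "0 < norm1 h"
      unfolding norm1_def using w by (simp add: sum_nonneg less_imp_le order_less_le)
    define g where "g x = 1 / norm1 h * h x" for x
    have g: "g \<in> fspan n z" unfolding g_def by (intro fspan_cmult h)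
    have ng: "norm1 g = 1"
    proof -
      have "norm1 g = 1 / norm1 h * norm1 h"
        unfolding norm1_def[of g] norm1_def[of h, symmetric] g_def
        using v by (simp add: abs_mult norm1_def sum_distrib_left sum_divide_distrib)
      then show ?thesis using v by simp
    qed
    have "\<tau> g \<in> T" using g ng by (auto simp: T_def)
    from close[OF this] have "\<bar>real m - real m * (\<Sum>x\<leftarrow>xs. c x * \<bar>g x\<bar>)\<bar> \<le> real m / 2"
      by (simp add: norm_\<tau> ng sum_\<tau>[OF xs(1)])
    also have "real m - real m * (\<Sum>x\<leftarrow>xs. c x * \<bar>g x\<bar>) = real m * (1 - (\<Sum>x\<leftarrow>xs. c x * \<bar>g x\<bar>))"
      by (simp add: algebra_simps)
    finally have "\<bar>1 - (\<Sum>x\<leftarrow>xs. c x * \<bar>g x\<bar>)\<bar> \<le> 1 / 2"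
      using mpos by (simp add: abs_mult)
    then have "norm1 h * \<bar>1 - (\<Sum>x\<leftarrow>xs. c x * \<bar>g x\<bar>)\<bar> \<le> norm1 h * (1 / 2)"
      using v by (intro mult_left_mono) auto
    moreover have "norm1 h * (\<Sum>x\<leftarrow>ys. c x * \<bar>g x\<bar>) = (\<Sum>x\<leftarrow>ys. c x * \<bar>h x\<bar>)" for ys
      by (induction ys) (use v in \<open>auto simp: g_def abs_mult distrib_left\<close>)
    ultimately show ?thesis
      using v by (metis (no_types, lifting) abs_mult abs_of_pos mult.right_neutral right_diff_distrib times_divide_eq_right)
  qed
  then show ?thesis
    using xs I mpos \<rho> unfolding norm1_def
    by (intro exI[of _ xs] exI[of _ c]) (auto simp: c_def less_imp_le)
qed

section \<open>Discretization of the integral norm\<close>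

text \<open>The cells on which all \<open>\<phi>\<^sub>i / \<rho>\<close> vary by at most \<open>\<delta>\<close> are indexed by the rounded values of
  these quotients; one point is picked in each cell of positive \<open>\<rho> \<mu>\<close>-mass.\<close>

lemma measure_to_finite_weights:
  fixes \<mu> :: "'a measure" and z :: "nat \<Rightarrow> 'a \<Rightarrow> real"
  assumes z: "\<And>i. i < n \<Longrightarrow> integrable \<mu> (z i)"
    and nontriv: "h0 \<in> fspan n z" "0 < (LINT x|\<mu>. \<bar>h0 x\<bar>)"
  shows "\<exists>(S :: (nat \<Rightarrow> int) set) w y. finite S \<and> S \<noteq> {}
    \<and> (\<forall>s\<in>S. 0 < w s \<and> y s \<in> space \<mu> \<and> (\<exists>i<n. z i (y s) \<noteq> 0))
    \<and> (\<forall>h\<in>fspan n z. \<bar>(LINT x|\<mu>. \<bar>h x\<bar>) - (\<Sum>s\<in>S. w s * \<bar>h (y s)\<bar>)\<bar> \<le> (LINT x|\<mu>. \<bar>h x\<bar>) / 2)"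
proof -
  \<comment> \<open>The \<open>z i\<close> are only in L1, so products of two of them need not be
    integrable. Dividing by the integrable majorant \<open>\<rho>\<close> repairs this for all
    functions dominated by a multiple of \<open>\<rho>\<close>. Where \<open>\<rho>\<close> vanishes
    such functions vanish too, and the quotient has the value 0 there.\<close>
  define \<rho> where "\<rho> x = (\<Sum>i<n. \<bar>z i x\<bar>)" for x
  define V where "V = {f \<in> borel_measurable \<mu>. \<exists>C. \<forall>x. \<bar>f x\<bar> \<le> C * \<rho> x}"
  define B where "B f g = (LINT x|\<mu>. f x * g x / \<rho> x)" for f g
  have \<rho>0: "0 \<le> \<rho> x" for x by (simp add: \<rho>_def sum_nonneg)
  have \<rho>_int: "integrable \<mu> \<rho>"
    unfolding \<rho>_def using z by (intro Bochner_Integration.integrable_sum integrable_abs) auto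
  then have \<rho>_meas[measurable]: "\<rho> \<in> borel_measurable \<mu>" by simp
  have V_meas: "f \<in> borel_measurable \<mu>" if "f \<in> V" for f using that by (simp add: V_def)
  have V_bound: "\<exists>C\<ge>0. \<forall>x. \<bar>f x\<bar> \<le> C * \<rho> x" if f: "f \<in> V" for f
  proof -
    obtain C where C: "\<forall>x. \<bar>f x\<bar> \<le> C * \<rho> x" using f unfolding V_def by blast
    have "\<bar>f x\<bar> \<le> \<bar>C\<bar> * \<rho> x" for x
      using spec[OF C, of x] mult_right_mono[OF abs_ge_self[of C] \<rho>0[of x]] by linarith
    then show ?thesis by (intro exI[of _ "\<bar>C\<bar>"]) simp
  qed
  have V_zero: "f x = 0" if "f \<in> V" "\<rho> x = 0" for f x
    using V_bound[OF that(1)] that(2) by (metis abs_le_zero_iff mult_zero_right)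
  have B_int: "integrable \<mu> (\<lambda>x. f x * g x / \<rho> x)" if f: "f \<in> V" and g: "g \<in> V" for f g
  proof -
    obtain C where C: "0 \<le> C" "\<And>x. \<bar>f x\<bar> \<le> C * \<rho> x" using V_bound[OF f] by blast
    obtain D where D: "0 \<le> D" "\<And>x. \<bar>g x\<bar> \<le> D * \<rho> x" using V_bound[OF g] by blast
    note [measurable] = V_meas[OF f] V_meas[OF g]
    show ?thesis
    proof (rule Bochner_Integration.integrable_bound)
      show "integrable \<mu> (\<lambda>x. (C * D) * \<rho> x)" using \<rho>_int by simp
      show "AE x in \<mu>. norm (f x * g x / \<rho> x) \<le> norm ((C * D) * \<rho> x)"
      proof (rule AE_I2)
        fix x
        have "\<bar>f x\<bar> * \<bar>g x\<bar> \<le> (C * \<rho> x) * (D * \<rho> x)"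
          using C D \<rho>0[of x] by (intro mult_mono) auto
        then have "\<bar>f x\<bar> * \<bar>g x\<bar> / \<rho> x \<le> (C * \<rho> x) * (D * \<rho> x) / \<rho> x"
          using \<rho>0[of x] by (rule divide_right_mono)
        also have "\<dots> = C * D * \<rho> x" by simp
        finally show "norm (f x * g x / \<rho> x) \<le> norm ((C * D) * \<rho> x)"
          using C D \<rho>0[of x] by (simp add: abs_mult)
      qed
    qed measurable
  qed
  have V_zero_mem: "(\<lambda>x. 0) \<in> V" by (auto simp: V_def intro!: exI[of _ 0])
  have V_add: "(\<lambda>x. f x + g x) \<in> V" if f: "f \<in> V" and g: "g \<in> V" for f g
  proof -
    obtain C where C: "\<And>x. \<bar>f x\<bar> \<le> C * \<rho> x" using V_bound[OF f] by blast
    obtain D where D: "\<And>x. \<bar>g x\<bar> \<le> D * \<rho> x" using V_bound[OF g] by blast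
    have "\<bar>f x + g x\<bar> \<le> (C + D) * \<rho> x" for x
      using C[of x] D[of x] abs_triangle_ineq[of "f x" "g x"] by (simp add: distrib_right)
    then show ?thesis using V_meas f g by (auto simp: V_def)
  qed
  have V_cmult: "(\<lambda>x. c * f x) \<in> V" if f: "f \<in> V" for f c
  proof -
    obtain C where C: "\<And>x. \<bar>f x\<bar> \<le> C * \<rho> x" using V_bound[OF f] by blast
    have "\<bar>c * f x\<bar> \<le> (\<bar>c\<bar> * C) * \<rho> x" for x
      using mult_left_mono[OF C[of x], of "\<bar>c\<bar>"] by (simp add: abs_mult mult.assoc)
    then show ?thesis using V_meas f by (auto simp: V_def)
  qed
  interpret semi_inner_product V B
  proof unfold_locales
    show "B (\<lambda>x. f x + g x) h = B f h + B g h" if "f \<in> V" "g \<in> V" "h \<in> V" for f g h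
      unfolding B_def using B_int[OF that(1,3)] B_int[OF that(2,3)]
      by (simp add: distrib_right add_divide_distrib)
    show "B (\<lambda>x. c * f x) h = c * B f h" for f h c
    proof -
      have eq: "(\<lambda>x. c * f x * h x / \<rho> x) = (\<lambda>x. c * (f x * h x / \<rho> x))" by auto
      show ?thesis unfolding B_def eq by (rule integral_mult_right_zero)
    qed
    show "0 \<le> B f f" for f
      unfolding B_def using \<rho>0 by (intro integral_nonneg_AE) auto
  qed (use V_zero_mem V_add V_cmult in \<open>auto simp: B_def mult.commute\<close>)
  have zV: "z i \<in> V" if i: "i < n" for i
  proof -
    have "\<bar>z i x\<bar> \<le> 1 * \<rho> x" for x
      unfolding \<rho>_def using i by (auto intro!: member_le_sum[of i _ "\<lambda>i. \<bar>z i x\<bar>"])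
    then show ?thesis using z[OF i] unfolding V_def by blast
  qed
  obtain r \<phi> where r\<phi>: "spans_orthonormally n z r \<phi>"
    using gram_schmidt[of n z, OF zV] by blast
  note \<phi>V = spans_orthonormallyD(3)[OF r\<phi>] and orth = spans_orthonormallyD(4)[OF r\<phi>]
  have "\<forall>i<r. \<exists>C\<ge>0. \<forall>x. \<bar>\<phi> i x\<bar> \<le> C * \<rho> x" using V_bound \<phi>V by blast
  then obtain C' where C': "\<And>i. i < r \<Longrightarrow> 0 \<le> C' i" "\<And>i x. i < r \<Longrightarrow> \<bar>\<phi> i x\<bar> \<le> C' i * \<rho> x"
    by metis
  define C where "C = (\<Sum>i<r. C' i)"
  have C0: "0 \<le> C" unfolding C_def using C' by (intro sum_nonneg) auto
  have \<phi>C: "\<bar>\<phi> i x\<bar> \<le> C * \<rho> x" if i: "i < r" for i x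
  proof -
    have "C' i \<le> C" unfolding C_def using C'(1) i by (intro member_le_sum) auto
    then show ?thesis using C'(2)[OF i, of x] mult_right_mono[OF _ \<rho>0[of x]] by (meson order_trans)
  qed
  obtain a where a: "B (\<lambda>x. z j x - (\<Sum>i<r. a j i * \<phi> i x)) (\<lambda>x. z j x - (\<Sum>i<r. a j i * \<phi> i x)) = 0"
    if "j < n" for j
    using spans_orthonormallyD(5)[OF r\<phi>] by blast
  \<comment> \<open>The expansions hold only almost everywhere. Sample points will be taken in this
    set of full measure, because point values of \<open>h\<close> must be read off from its
    coefficients.\<close>
  define G where "G x \<longleftrightarrow> (\<forall>j<n. z j x = (\<Sum>i<r. a j i * \<phi> i x))" for x
  have AE_G: "AE x in \<mu>. G x"
  proof -
    have "AE x in \<mu>. z j x = (\<Sum>i<r. a j i * \<phi> i x)" if j: "j < n" for j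
    proof -
      let ?e = "\<lambda>x. z j x - (\<Sum>i<r. a j i * \<phi> i x)"
      have eV: "?e \<in> V"
        by (intro diff_mem zV j sum_mem cmult_mem \<phi>V) auto
      have "AE x in \<mu>. ?e x * ?e x / \<rho> x = 0"
        using a[OF j] B_int[OF eV eV] \<rho>0 unfolding B_def
        by (subst (asm) integral_nonneg_eq_0_iff_AE) auto
      then show ?thesis
      proof eventually_elim
        case (elim x)
        then have "?e x = 0" using V_zero[OF eV, of x] by auto
        then show ?case by simp
      qed
    qed
    then have "AE x in \<mu>. \<forall>j\<in>{..<n}. z j x = (\<Sum>i<r. a j i * \<phi> i x)"
      by (intro AE_finite_allI) auto
    then show ?thesis unfolding G_def by (rule eventually_mono) auto
  qed
  have fspan_V: "h \<in> V" if "h \<in> fspan n z" for h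
    using that zV unfolding fspan_def by (auto intro!: sum_mem cmult_mem)
  have V_int: "integrable \<mu> f" if f: "f \<in> V" for f
  proof -
    obtain D where D: "0 \<le> D" "\<And>x. \<bar>f x\<bar> \<le> D * \<rho> x" using V_bound[OF f] by blast
    show ?thesis
      by (rule Bochner_Integration.integrable_bound[of _ "\<lambda>x. D * \<rho> x"])
        (use D \<rho>0 \<rho>_int V_meas[OF f] in \<open>auto simp: abs_mult\<close>)
  qed
  \<comment> \<open>The coefficients are \<open>B h (\<phi> i)\<close>, and
    \<open>\<phi> i / \<rho>\<close> is bounded by \<open>C\<close>; hence they are controlled by
    the L1 norm of \<open>h\<close>.\<close>
  have expand: "\<exists>b. (\<forall>x. G x \<longrightarrow> h x = (\<Sum>i<r. b i * \<phi> i x)) \<and> (\<forall>i<r. \<bar>b i\<bar> \<le> C * (LINT x|\<mu>. \<bar>h x\<bar>))"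
    if h: "h \<in> fspan n z" for h
  proof -
    obtain c where c: "h = (\<lambda>x. \<Sum>j<n. c j * z j x)" using h by (auto simp: fspan_def)
    define b where "b i = (\<Sum>j<n. c j * a j i)" for i
    note hV = fspan_V[OF h]
    have hb: "h x = (\<Sum>i<r. b i * \<phi> i x)" if "G x" for x
    proof -
      have "h x = (\<Sum>j<n. c j * (\<Sum>i<r. a j i * \<phi> i x))"
        unfolding c using that by (intro sum.cong) (auto simp: G_def)
      also have "\<dots> = (\<Sum>i<r. \<Sum>j<n. c j * (a j i * \<phi> i x))"
        by (simp only: sum_distrib_left) (rule sum.swap)
      finally show ?thesis by (simp add: b_def sum_distrib_right mult.assoc)
    qed
    have bV: "(\<lambda>x. \<Sum>k<r. b k * \<phi> k x) \<in> V" by (intro sum_mem cmult_mem \<phi>V) auto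
    have "\<bar>b i\<bar> \<le> C * (LINT x|\<mu>. \<bar>h x\<bar>)" if i: "i < r" for i
    proof -
      have "B (\<lambda>x. \<Sum>k<r. b k * \<phi> k x) (\<phi> i) = (\<Sum>k<r. b k * B (\<phi> k) (\<phi> i))"
        by (rule sum_cmult_left) (auto intro: \<phi>V i)
      also have "\<dots> = (\<Sum>k<r. if k = i then b i else 0)"
        by (intro sum.cong) (auto simp: orth i)
      also have "\<dots> = b i" using i by simp
      also have "B (\<lambda>x. \<Sum>k<r. b k * \<phi> k x) (\<phi> i) = B h (\<phi> i)"
        unfolding B_def
      proof (rule integral_cong_AE)
        show "AE x in \<mu>. (\<Sum>k<r. b k * \<phi> k x) * \<phi> i x / \<rho> x = h x * \<phi> i x / \<rho> x"
          using AE_G by eventually_elim (simp add: hb)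
      qed (use B_int[OF bV \<phi>V[OF i]] B_int[OF hV \<phi>V[OF i]] in auto)
      finally have "\<bar>b i\<bar> \<le> (LINT x|\<mu>. \<bar>h x * \<phi> i x / \<rho> x\<bar>)"
        unfolding B_def by (metis integral_abs_bound)
      also have "\<dots> \<le> (LINT x|\<mu>. C * \<bar>h x\<bar>)"
      proof (rule integral_mono)
        fix x
        have "\<bar>h x\<bar> * \<bar>\<phi> i x\<bar> / \<rho> x \<le> \<bar>h x\<bar> * (C * \<rho> x) / \<rho> x"
          using \<phi>C[OF i, of x] \<rho>0[of x] by (intro divide_right_mono mult_left_mono) auto
        also have "\<dots> \<le> C * \<bar>h x\<bar>" using C0 by simp
        finally show "\<bar>h x * \<phi> i x / \<rho> x\<bar> \<le> C * \<bar>h x\<bar>" using \<rho>0[of x] by (simp add: abs_mult)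
      qed (use integrable_abs[OF B_int[OF hV \<phi>V[OF i]]] V_int[OF hV] in simp_all)
      finally show ?thesis by simp
    qed
    with hb show ?thesis by blast
  qed
  \<comment> \<open>The total error will be at most \<open>\<delta> * r * C\<close> times the
    integral of \<open>\<rho>\<close>, relative to the L1 norm of \<open>h\<close>; this choice
    makes it at most 1/2. The summand 1 keeps the denominator positive.\<close>
  define \<delta> where "\<delta> = 1 / (2 * (real r * C * (LINT x|\<mu>. \<rho> x) + 1))"
  have I\<rho>: "0 \<le> (LINT x|\<mu>. \<rho> x)" using \<rho>0 by (intro integral_nonneg_AE) auto
  then have den: "0 \<le> real r * C * (LINT x|\<mu>. \<rho> x)" using C0 by simp
  then have \<delta>: "0 < \<delta>" by (simp add: \<delta>_def)
  have \<delta>_small: "\<delta> * (real r * C * (LINT x|\<mu>. \<rho> x)) \<le> 1 / 2"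
    using den by (simp add: \<delta>_def field_simps)
  define g where "g i x = \<phi> i x / \<rho> x" for i x
  have gC: "\<bar>g i x\<bar> \<le> C" if "i < r" for i x
    using \<phi>C[OF that, of x] \<rho>0[of x] C0 by (cases "\<rho> x = 0") (auto simp: g_def field_simps)
  have [measurable]: "\<phi> i \<in> borel_measurable \<mu>" if "i < r" for i using V_meas \<phi>V that by blast
  \<comment> \<open>The default value 0 from index \<open>r\<close> on makes the set of cell indices
    finite.\<close>
  define J where "J x = (\<lambda>i. if i < r then \<lfloor>g i x / \<delta>\<rfloor> else 0)" for x
  define cells where "cells = J ` space \<mu>"
  define E where "E j = {x \<in> space \<mu>. J x = j}" for j
  have fin: "finite cells"
  proof (rule finite_subset)
    have "\<lfloor>g i x / \<delta>\<rfloor> \<in> {\<lfloor>- C / \<delta>\<rfloor>..\<lfloor>C / \<delta>\<rfloor>}" if "i < r" for i x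
    proof -
      have "- C / \<delta> \<le> g i x / \<delta>" "g i x / \<delta> \<le> C / \<delta>"
        using gC[OF that, of x] \<delta> by (intro divide_right_mono; linarith)+
      then show ?thesis by (simp add: floor_mono)
    qed
    then show "cells \<subseteq> {f. \<forall>i. (i \<in> {..<r} \<longrightarrow> f i \<in> {\<lfloor>- C / \<delta>\<rfloor>..\<lfloor>C / \<delta>\<rfloor>}) \<and> (i \<notin> {..<r} \<longrightarrow> f i = 0)}"
      unfolding cells_def J_def by force
  qed (rule finite_set_of_finite_funs, auto)
  have E_sets[measurable]: "E j \<in> sets \<mu>" if "j \<in> cells" for j
  proof -
    have "E j = {x \<in> space \<mu>. \<forall>i\<in>{..<r}. \<lfloor>g i x / \<delta>\<rfloor> = j i}"
      using that by (auto simp: E_def cells_def J_def fun_eq_iff)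
    also have "\<dots> = space \<mu> \<inter> (\<Inter>i\<in>{..<r}. {x \<in> space \<mu>. \<lfloor>g i x / \<delta>\<rfloor> = j i})" by auto
    also have "\<dots> \<in> sets \<mu>"
    proof (cases "r = 0")
      case False
      have "{x \<in> space \<mu>. \<lfloor>g i x / \<delta>\<rfloor> = j i} \<in> sets \<mu>" if [simp]: "i < r" for i
        unfolding g_def by measurable
      with False show ?thesis by (intro sets.Int sets.finite_INT) auto
    qed auto
    finally show ?thesis .
  qed
  have split: "(LINT x|\<mu>. f x) = (\<Sum>j\<in>cells. LINT x|\<mu>. f x * indicator (E j) x)"
    if f: "integrable \<mu> f" for f :: "'a \<Rightarrow> real"
  proof -
    have "(\<Sum>j\<in>cells. LINT x|\<mu>. f x * indicator (E j) x) = (LINT x|\<mu>. (\<Sum>j\<in>cells. f x * indicator (E j) x))"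
      using f by (intro Bochner_Integration.integral_sum[symmetric] integrable_real_mult_indicator E_sets) auto
    also have "\<dots> = (LINT x|\<mu>. f x)"
    proof (rule Bochner_Integration.integral_cong[OF refl])
      fix x assume x: "x \<in> space \<mu>"
      have "(\<Sum>j\<in>cells. f x * indicator (E j) x) = (\<Sum>j\<in>cells. if j = J x then f x else 0)"
        using x by (intro sum.cong) (auto simp: E_def indicator_def)
      also have "\<dots> = f x" using fin x by (simp add: cells_def)
      finally show "(\<Sum>j\<in>cells. f x * indicator (E j) x) = f x" .
    qed
    finally show ?thesis by simp
  qed
  define W where "W j = (LINT x|\<mu>. \<rho> x * indicator (E j) x)" for j
  have W0: "0 \<le> W j" for j
    unfolding W_def using \<rho>0 by (intro integral_nonneg_AE) auto
  have ind_int: "integrable \<mu> (\<lambda>x. f x * indicator (E j) x)" if "integrable \<mu> f" "j \<in> cells"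
    for f :: "'a \<Rightarrow> real" and j
    using that by (intro integrable_real_mult_indicator E_sets) auto
  define S where "S = {j \<in> cells. 0 < W j}"
  have "\<forall>j\<in>S. \<exists>y. y \<in> space \<mu> \<and> J y = j \<and> G y \<and> 0 < \<rho> y"
  proof (rule ballI, rule ccontr)
    fix j assume j: "j \<in> S" and none: "\<not> (\<exists>y. y \<in> space \<mu> \<and> J y = j \<and> G y \<and> 0 < \<rho> y)"
    have "AE x in \<mu>. \<rho> x * indicator (E j) x = 0"
      using AE_G
    proof (rule AE_mp, intro AE_I2 impI)
      fix x assume "x \<in> space \<mu>" "G x"
      then show "\<rho> x * indicator (E j) x = 0"
        using none \<rho>0[of x] by (auto simp: E_def indicator_def order_less_le)
    qed
    then have "W j = 0" unfolding W_def by (rule integral_eq_zero_AE)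
    with j show False by (simp add: S_def)
  qed
  then obtain y where y: "\<And>j. j \<in> S \<Longrightarrow> y j \<in> space \<mu>" "\<And>j. j \<in> S \<Longrightarrow> J (y j) = j"
    "\<And>j. j \<in> S \<Longrightarrow> G (y j)" "\<And>j. j \<in> S \<Longrightarrow> 0 < \<rho> (y j)" by metis
  \<comment> \<open>With \<open>w j * \<rho> (y j) = W j\<close> the rule reproduces the mass of
    \<open>\<rho>\<close> on each cell in \<open>S\<close>.\<close>
  define w where "w j = W j / \<rho> (y j)" for j
  have main: "\<bar>(LINT x|\<mu>. \<bar>h x\<bar>) - (\<Sum>s\<in>S. w s * \<bar>h (y s)\<bar>)\<bar> \<le> (LINT x|\<mu>. \<bar>h x\<bar>) / 2"
    if h: "h \<in> fspan n z" for h
  proof -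
    note hV = fspan_V[OF h]
    let ?v = "LINT x|\<mu>. \<bar>h x\<bar>"
    have v0: "0 \<le> ?v" by (intro integral_nonneg_AE) auto
    have h_int: "integrable \<mu> (\<lambda>x. \<bar>h x\<bar>)" using V_int[OF hV] by simp
    obtain b where hb: "\<And>x. G x \<Longrightarrow> h x = (\<Sum>i<r. b i * \<phi> i x)"
      and b: "\<And>i. i < r \<Longrightarrow> \<bar>b i\<bar> \<le> C * ?v" using expand[OF h] by blast
    define \<beta> where "\<beta> = (\<Sum>i<r. \<bar>b i\<bar>)"
    have \<beta>0: "0 \<le> \<beta>" by (simp add: \<beta>_def sum_nonneg)
    have \<beta>: "\<beta> \<le> real r * C * ?v"
      unfolding \<beta>_def using sum_bounded_above[of "{..<r}" "\<lambda>i. \<bar>b i\<bar>" "C * ?v"] b by simp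
    have hg: "h x = \<rho> x * (\<Sum>i<r. b i * g i x)" if "G x" for x
    proof (cases "\<rho> x = 0")
      case True
      then show ?thesis using V_zero[OF hV] by simp
    next
      case False
      then show ?thesis using hb[OF that] by (simp add: g_def sum_distrib_left)
    qed
    \<comment> \<open>On a cell \<open>|h|\<close> is \<open>\<rho>\<close> times the absolute value
      of a combination of the \<open>g i\<close>, each varying by at most \<open>\<delta>\<close>. A
      cell outside \<open>S\<close> has no \<open>\<rho>\<close>-mass, and there the integral of
      \<open>|h|\<close> vanishes because \<open>h\<close> is dominated by
      \<open>\<rho>\<close>.\<close>
    have cell: "\<bar>(LINT x|\<mu>. \<bar>h x\<bar> * indicator (E j) x) - (if j \<in> S then w j * \<bar>h (y j)\<bar> else 0)\<bar>
        \<le> \<delta> * \<beta> * W j" if j: "j \<in> cells" for j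
    proof (cases "j \<in> S")
      case True
      define \<kappa> where "\<kappa> = \<bar>\<Sum>i<r. b i * g i (y j)\<bar>"
      have wk: "w j * \<bar>h (y j)\<bar> = \<kappa> * W j"
        using y(4)[OF True] unfolding hg[OF y(3)[OF True]] by (simp add: w_def \<kappa>_def abs_mult)
      have "(LINT x|\<mu>. \<bar>h x\<bar> * indicator (E j) x) - \<kappa> * W j
          = (LINT x|\<mu>. \<bar>h x\<bar> * indicator (E j) x - \<kappa> * (\<rho> x * indicator (E j) x))"
        using ind_int[OF h_int j] ind_int[OF \<rho>_int j] by (simp add: W_def)
      also have "\<bar>\<dots>\<bar> \<le> (LINT x|\<mu>. \<bar>\<bar>h x\<bar> * indicator (E j) x - \<kappa> * (\<rho> x * indicator (E j) x)\<bar>)"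
        by (rule integral_abs_bound)
      also have "\<dots> \<le> (LINT x|\<mu>. \<delta> * \<beta> * (\<rho> x * indicator (E j) x))"
      proof (rule integral_mono_AE)
        show "AE x in \<mu>. \<bar>\<bar>h x\<bar> * indicator (E j) x - \<kappa> * (\<rho> x * indicator (E j) x)\<bar>
            \<le> \<delta> * \<beta> * (\<rho> x * indicator (E j) x)"
          using AE_G
        proof (rule AE_mp, intro AE_I2 impI)
          fix x assume "x \<in> space \<mu>" and Gx: "G x"
          show "\<bar>\<bar>h x\<bar> * indicator (E j) x - \<kappa> * (\<rho> x * indicator (E j) x)\<bar>
            \<le> \<delta> * \<beta> * (\<rho> x * indicator (E j) x)"
          proof (cases "x \<in> E j")
            case xE: True
            have close: "\<bar>g i x - g i (y j)\<bar> \<le> \<delta>" if i: "i < r" for i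
            proof -
              have "J x = J (y j)" using xE y(2)[OF True] by (simp add: E_def)
              from fun_cong[OF this, of i] have "\<lfloor>g i x / \<delta>\<rfloor> = \<lfloor>g i (y j) / \<delta>\<rfloor>"
                using i by (simp add: J_def)
              then have "\<bar>g i x / \<delta> - g i (y j) / \<delta>\<bar> \<le> 1" by linarith
              then have "\<bar>(g i x - g i (y j)) / \<delta>\<bar> \<le> 1" by (simp add: diff_divide_distrib)
              then show ?thesis using \<delta> by (simp add: abs_divide)
            qed
            have "\<bar>\<bar>\<Sum>i<r. b i * g i x\<bar> - \<kappa>\<bar> \<le> \<bar>(\<Sum>i<r. b i * g i x) - (\<Sum>i<r. b i * g i (y j))\<bar>"
              unfolding \<kappa>_def by linarith
            also have "\<dots> = \<bar>\<Sum>i<r. b i * (g i x - g i (y j))\<bar>"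
              by (simp add: right_diff_distrib sum_subtractf)
            also have "\<dots> \<le> (\<Sum>i<r. \<bar>b i\<bar> * \<bar>g i x - g i (y j)\<bar>)"
              using sum_abs[of "\<lambda>i. b i * (g i x - g i (y j))" "{..<r}"] by (simp add: abs_mult)
            also have "\<dots> \<le> (\<Sum>i<r. \<bar>b i\<bar> * \<delta>)"
              using close by (intro sum_mono mult_left_mono) auto
            also have "\<dots> = \<delta> * \<beta>" by (simp add: \<beta>_def sum_distrib_left mult.commute)
            finally have le: "\<bar>\<bar>\<Sum>i<r. b i * g i x\<bar> - \<kappa>\<bar> \<le> \<delta> * \<beta>" .
            have "\<bar>h x\<bar> - \<kappa> * \<rho> x = \<rho> x * (\<bar>\<Sum>i<r. b i * g i x\<bar> - \<kappa>)"
              unfolding hg[OF Gx] using \<rho>0[of x] by (simp add: abs_mult algebra_simps)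
            then have "\<bar>\<bar>h x\<bar> - \<kappa> * \<rho> x\<bar> = \<rho> x * \<bar>\<bar>\<Sum>i<r. b i * g i x\<bar> - \<kappa>\<bar>"
              using \<rho>0[of x] by (simp add: abs_mult)
            also have "\<dots> \<le> \<rho> x * (\<delta> * \<beta>)" using le \<rho>0[of x] by (intro mult_left_mono)
            finally show ?thesis using xE by (simp add: mult.commute)
          qed simp
        qed
      qed (use ind_int[OF h_int j] ind_int[OF \<rho>_int j] in auto)
      also have "\<dots> = \<delta> * \<beta> * W j" by (simp add: W_def)
      finally show ?thesis using True wk by simp
    next
      case False
      then have Wj: "W j = 0" using W0[of j] j by (auto simp: S_def)
      obtain D where D: "0 \<le> D" "\<And>x. \<bar>h x\<bar> \<le> D * \<rho> x" using V_bound[OF hV] by blast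
      have "(LINT x|\<mu>. \<bar>h x\<bar> * indicator (E j) x) \<le> (LINT x|\<mu>. D * (\<rho> x * indicator (E j) x))"
        using D by (intro integral_mono integrable_mult_right ind_int h_int \<rho>_int j)
          (auto simp: indicator_def)
      also have "\<dots> = 0" using Wj by (simp add: W_def)
      finally have "(LINT x|\<mu>. \<bar>h x\<bar> * indicator (E j) x) \<le> 0" .
      moreover have "0 \<le> (LINT x|\<mu>. \<bar>h x\<bar> * indicator (E j) x)"
        by (intro integral_nonneg_AE) auto
      ultimately show ?thesis using False Wj by simp
    qed
    have "(\<Sum>s\<in>S. w s * \<bar>h (y s)\<bar>) = (\<Sum>j\<in>cells. if j \<in> S then w j * \<bar>h (y j)\<bar> else 0)"
      unfolding S_def using fin by (simp add: sum.inter_filter)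
    then have "?v - (\<Sum>s\<in>S. w s * \<bar>h (y s)\<bar>) = (\<Sum>j\<in>cells.
        (LINT x|\<mu>. \<bar>h x\<bar> * indicator (E j) x) - (if j \<in> S then w j * \<bar>h (y j)\<bar> else 0))"
      using split[OF h_int] by (simp add: sum_subtractf)
    also have "\<bar>\<dots>\<bar> \<le> (\<Sum>j\<in>cells. \<delta> * \<beta> * W j)"
      by (rule order_trans[OF sum_abs sum_mono[OF cell]])
    also have "\<dots> = \<delta> * \<beta> * (LINT x|\<mu>. \<rho> x)"
      using split[OF \<rho>_int] by (simp add: W_def sum_distrib_left)
    also have "\<dots> \<le> \<delta> * (real r * C * ?v) * (LINT x|\<mu>. \<rho> x)"
      using \<beta> \<delta> I\<rho> by (intro mult_right_mono mult_left_mono) auto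
    also have "\<dots> = \<delta> * (real r * C * (LINT x|\<mu>. \<rho> x)) * ?v" by (simp add: ac_simps)
    also have "\<dots> \<le> 1 / 2 * ?v" using \<delta>_small v0 by (rule mult_right_mono)
    finally show ?thesis by simp
  qed
  have "S \<noteq> {}"
    using main[OF nontriv(1)] nontriv(2) by auto
  moreover have "finite S" using fin by (simp add: S_def)
  moreover have "0 < w s \<and> y s \<in> space \<mu> \<and> (\<exists>i<n. z i (y s) \<noteq> 0)" if s: "s \<in> S" for s
  proof -
    have "\<exists>i<n. z i (y s) \<noteq> 0"
    proof (rule ccontr)
      assume "\<not> ?thesis"
      then have "\<rho> (y s) = 0" by (simp add: \<rho>_def)
      then show False using y(4)[OF s] by simp
    qed
    then show ?thesis using y(1,4)[OF s] s by (simp add: w_def S_def)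
  qed
  ultimately show ?thesis using main by blast
qed

text \<open>Two approximations with relative error 1/2 are composed: the factors 1/4 and 9/4 are the
  squares of 1/2 and 3/2. The finite sampling result is applied on the index set of the cells, to
  the functions \<open>z i\<close> composed with \<open>y\<close>.\<close>

lemma L1_sampling_discretization:
  fixes \<mu> :: "'a measure" and z :: "nat \<Rightarrow> 'a \<Rightarrow> real"
  assumes z: "\<And>i. i < n \<Longrightarrow> integrable \<mu> (z i)"
    and nontriv: "h0 \<in> fspan n z" "0 < (LINT x|\<mu>. \<bar>h0 x\<bar>)"
    and m: "1024 * real n * (ln (4 * real n) + 2) \<le> real m"
  shows "\<exists>\<xi> c. (\<forall>k<m. \<xi> k \<in> space \<mu> \<and> 0 \<le> c k) \<and> (\<forall>h\<in>fspan n z.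
    (LINT x|\<mu>. \<bar>h x\<bar>) / 4 \<le> (\<Sum>k<m. c k * \<bar>h (\<xi> k)\<bar>) \<and>
    (\<Sum>k<m. c k * \<bar>h (\<xi> k)\<bar>) \<le> 9 / 4 * (LINT x|\<mu>. \<bar>h x\<bar>))"
proof -
  obtain S :: "(nat \<Rightarrow> int) set" and w y where S: "finite S" "S \<noteq> {}"
    and wy: "\<And>s. s \<in> S \<Longrightarrow> 0 < w s" "\<And>s. s \<in> S \<Longrightarrow> y s \<in> space \<mu>" "\<And>s. s \<in> S \<Longrightarrow> \<exists>i<n. z i (y s) \<noteq> 0"
    and approx: "\<And>h. h \<in> fspan n z \<Longrightarrow>
      \<bar>(LINT x|\<mu>. \<bar>h x\<bar>) - (\<Sum>s\<in>S. w s * \<bar>h (y s)\<bar>)\<bar> \<le> (LINT x|\<mu>. \<bar>h x\<bar>) / 2"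
    using measure_to_finite_weights[of n \<mu> z h0, OF z nontriv] by blast
  obtain xs c where xs: "set xs \<subseteq> S" "length xs = m" and c: "\<And>s. s \<in> S \<Longrightarrow> 0 \<le> c s"
    and sample: "\<And>h. h \<in> fspan n (\<lambda>i s. z i (y s)) \<Longrightarrow>
      \<bar>(\<Sum>s\<in>S. w s * \<bar>h s\<bar>) - (\<Sum>x\<leftarrow>xs. c x * \<bar>h x\<bar>)\<bar> \<le> (\<Sum>s\<in>S. w s * \<bar>h s\<bar>) / 2"
    using finite_L1_sampling[of S w n "\<lambda>i s. z i (y s)", OF S wy(1,3) m] by blast
  have mem: "xs ! k \<in> S" if "k < m" for k using xs that by auto
  show ?thesis
  proof (intro exI[of _ "\<lambda>k. y (xs ! k)"] exI[of _ "\<lambda>k. c (xs ! k)"] conjI ballI allI impI)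
    fix h assume h: "h \<in> fspan n z"
    let ?v = "LINT x|\<mu>. \<bar>h x\<bar>" and ?s = "\<Sum>s\<in>S. w s * \<bar>h (y s)\<bar>"
    have "(\<lambda>s. h (y s)) \<in> fspan n (\<lambda>i s. z i (y s))" using h by (auto simp: fspan_def)
    note sample[OF this]
    moreover have "(\<Sum>x\<leftarrow>xs. c x * \<bar>h (y x)\<bar>) = (\<Sum>k<m. c (xs ! k) * \<bar>h (y (xs ! k))\<bar>)"
      using xs(2) by (simp add: sum_list_sum_nth atLeast0LessThan)
    ultimately have "\<bar>?s - (\<Sum>k<m. c (xs ! k) * \<bar>h (y (xs ! k))\<bar>)\<bar> \<le> ?s / 2" by simp
    moreover have "\<bar>?v - ?s\<bar> \<le> ?v / 2" by (rule approx[OF h])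
    ultimately show "?v / 4 \<le> (\<Sum>k<m. c (xs ! k) * \<bar>h (y (xs ! k))\<bar>)"
      "(\<Sum>k<m. c (xs ! k) * \<bar>h (y (xs ! k))\<bar>) \<le> 9 / 4 * ?v" by linarith+
  qed (use mem wy c in auto)
qed

section \<open>Sampling of the uniform norm\<close>

lemma (in semi_inner_product) orthonormal_family_complete:
  assumes definite: "\<And>f. f \<in> V \<Longrightarrow> B f f = 0 \<Longrightarrow> f = (\<lambda>x. 0)"
    and V: "V = fspan n z" and \<phi>: "spans_orthonormally n z n \<phi>"
    and u: "\<And>i. i < n \<Longrightarrow> u i \<in> V"
      "\<And>i j. i < n \<Longrightarrow> j < n \<Longrightarrow> B (u i) (u j) = (if i = j then 1 else 0)"
    and f: "f \<in> V"
  shows "f = (\<lambda>x. \<Sum>i<n. B f (u i) * u i x)"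
proof -
  note \<phi>V = spans_orthonormallyD(3)[OF \<phi>]
  have zV: "z i \<in> V" if "i < n" for i unfolding V by (rule fspan_base[OF that])
  have coeff: "B (\<lambda>x. \<Sum>j<n. b j * e j x) (e i) = b i"
    if "\<And>i. i < n \<Longrightarrow> e i \<in> V"
      "\<And>i j. i < n \<Longrightarrow> j < n \<Longrightarrow> B (e i) (e j) = (if i = j then 1 else 0)" "i < n" for b e i
  proof -
    have "B (\<lambda>x. \<Sum>j<n. b j * e j x) (e i) = (\<Sum>j<n. b j * B (e j) (e i))"
      using that by (intro sum_cmult_left) auto
    also have "\<dots> = (\<Sum>j<n. if j = i then b i else 0)"
      using that by (intro sum.cong) auto
    finally show ?thesis using that(3) by simp
  qed
  have coeff\<phi>: "B (\<lambda>x. \<Sum>j<n. b j * \<phi> j x) (\<phi> i) = b i" if "i < n" for b i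
    by (rule coeff[OF _ _ that]) (auto intro: \<phi>V simp: spans_orthonormallyD(4)[OF \<phi>])
  have coeffu: "B (\<lambda>x. \<Sum>j<n. b j * u j x) (u i) = b i" if "i < n" for b i
    by (rule coeff[OF _ _ that]) (auto simp: u)
  obtain a where a: "B (\<lambda>x. z j x - (\<Sum>i<n. a j i * \<phi> i x)) (\<lambda>x. z j x - (\<Sum>i<n. a j i * \<phi> i x)) = 0"
    if "j < n" for j
    using spans_orthonormallyD(5)[OF \<phi>] by blast
  have z\<phi>: "z j x = (\<Sum>i<n. a j i * \<phi> i x)" if j: "j < n" for j x
  proof -
    have "(\<lambda>x. z j x - (\<Sum>i<n. a j i * \<phi> i x)) = (\<lambda>x. 0)"
      by (rule definite[OF _ a[OF j]]) (intro diff_mem zV j sum_mem cmult_mem \<phi>V, auto)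
    from fun_cong[OF this, of x] show ?thesis by simp
  qed
  have expand: "\<exists>b. h = (\<lambda>x. \<Sum>i<n. b i * \<phi> i x)" if h: "h \<in> V" for h
  proof -
    obtain c where c: "h = (\<lambda>x. \<Sum>j<n. c j * z j x)" using h unfolding V fspan_def by blast
    have "h x = (\<Sum>i<n. (\<Sum>j<n. c j * a j i) * \<phi> i x)" for x
    proof -
      have "h x = (\<Sum>j<n. c j * (\<Sum>i<n. a j i * \<phi> i x))"
        unfolding c by (intro sum.cong) (auto simp: z\<phi>)
      also have "\<dots> = (\<Sum>i<n. \<Sum>j<n. c j * (a j i * \<phi> i x))"
        by (simp only: sum_distrib_left) (rule sum.swap)
      finally show ?thesis by (simp add: sum_distrib_right mult.assoc)
    qed
    then have "h = (\<lambda>x. \<Sum>i<n. (\<Sum>j<n. c j * a j i) * \<phi> i x)" by (rule ext)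
    then show ?thesis by (intro exI[of _ "\<lambda>i. \<Sum>j<n. c j * a j i"])
  qed
  have "\<forall>i<n. \<exists>b. u i = (\<lambda>x. \<Sum>j<n. b j * \<phi> j x)" using expand u(1) by blast
  then obtain b where b: "\<And>i. i < n \<Longrightarrow> u i = (\<lambda>x. \<Sum>j<n. b i j * \<phi> j x)" by metis
  have bu: "B (u i) (\<phi> j) = b i j" if "i < n" "j < n" for i j
    using coeff\<phi>[OF that(2), of "b i"] b[OF that(1)] by simp
  have row: "(\<Sum>j<n. (b i j)\<^sup>2) = 1" if i: "i < n" for i
  proof -
    have "(\<Sum>j<n. (b i j)\<^sup>2) = (\<Sum>j<n. b i j * B (\<phi> j) (u i))"
      using bu[OF i] sym[OF \<phi>V u(1)[OF i]] by (intro sum.cong) (auto simp: power2_eq_square)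
    also have "\<dots> = B (\<lambda>x. \<Sum>j<n. b i j * \<phi> j x) (u i)"
      by (rule sum_cmult_left[symmetric]) (auto intro: \<phi>V u i)
    also have "\<dots> = 1" using u(2)[OF i i] by (simp flip: b[OF i])
    finally show ?thesis .
  qed
  define P where "P j = (\<lambda>x. \<Sum>i<n. b i j * u i x)" for j
  define d where "d j = (\<lambda>x. \<phi> j x - P j x)" for j
  have PV: "P j \<in> V" for j unfolding P_def by (intro sum_mem cmult_mem u) auto
  have dV: "d j \<in> V" if "j < n" for j unfolding d_def by (intro diff_mem \<phi>V PV that)
  have norm_d: "B (d j) (d j) = 1 - (\<Sum>i<n. (b i j)\<^sup>2)" if j: "j < n" for j
  proof -
    have Pu: "B (P j) (u i) = b i j" if "i < n" for i
      unfolding P_def by (rule coeffu[OF that])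
    have Pg: "B (P j) g = (\<Sum>i<n. b i j * B (u i) g)" if "g \<in> V" for g
      unfolding P_def by (rule sum_cmult_left) (auto intro: u that)
    have P\<phi>: "B (P j) (\<phi> j) = (\<Sum>i<n. (b i j)\<^sup>2)"
      unfolding Pg[OF \<phi>V[OF j]] using bu j by (intro sum.cong) (auto simp: power2_eq_square)
    have PP: "B (P j) (P j) = (\<Sum>i<n. (b i j)\<^sup>2)"
      unfolding Pg[OF PV] using Pu sym[OF PV u(1)] by (intro sum.cong) (auto simp: power2_eq_square)
    have "B (d j) (d j) = B (\<phi> j) (d j) - B (P j) (d j)"
      unfolding d_def[of j] by (intro diff_left \<phi>V PV j diff_mem)
    also have "B (\<phi> j) (d j) = B (\<phi> j) (\<phi> j) - B (P j) (\<phi> j)"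
      unfolding sym[OF \<phi>V[OF j] dV[OF j]] unfolding d_def by (intro diff_left \<phi>V PV j)
    also have "B (P j) (d j) = B (\<phi> j) (P j) - B (P j) (P j)"
      unfolding sym[OF PV dV[OF j]] unfolding d_def by (intro diff_left \<phi>V PV j)
    finally show ?thesis
      using spans_orthonormallyD(4)[OF \<phi> j j] P\<phi> PP sym[OF \<phi>V[OF j] PV[of j]] by simp
  qed
  \<comment> \<open>Bessel: each column of \<open>b\<close> has square sum at most 1, and all entries together have square sum \<open>n\<close>.\<close>
  have "(\<Sum>j<n. B (d j) (d j)) = (\<Sum>j<n. 1 - (\<Sum>i<n. (b i j)\<^sup>2))"
    using norm_d by (intro sum.cong) auto
  also have "\<dots> = real n - (\<Sum>i<n. \<Sum>j<n. (b i j)\<^sup>2)"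
    by (simp add: sum_subtractf) (rule sum.swap)
  also have "\<dots> = 0" by (simp add: row)
  finally have "\<forall>j\<in>{..<n}. B (d j) (d j) = 0"
    using nonneg[OF dV] by (subst (asm) sum_nonneg_eq_0_iff) auto
  then have d0: "d j = (\<lambda>x. 0)" if "j < n" for j
    using definite[OF dV] that by simp
  have \<phi>u: "\<phi> j x = (\<Sum>i<n. b i j * u i x)" if "j < n" for j x
  proof -
    have "d j x = 0" by (simp add: d0[OF that])
    then show ?thesis by (simp add: d_def P_def)
  qed
  obtain c where c: "f = (\<lambda>x. \<Sum>j<n. c j * \<phi> j x)" using expand[OF f] by blast
  define e where "e i = (\<Sum>j<n. c j * b i j)" for i
  have fe: "f = (\<lambda>x. \<Sum>i<n. e i * u i x)"
  proof
    fix x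
    have "f x = (\<Sum>j<n. c j * (\<Sum>i<n. b i j * u i x))"
      unfolding c by (intro sum.cong) (auto simp: \<phi>u)
    also have "\<dots> = (\<Sum>i<n. \<Sum>j<n. c j * (b i j * u i x))"
      by (simp only: sum_distrib_left) (rule sum.swap)
    finally show "f x = (\<Sum>i<n. e i * u i x)" by (simp add: e_def sum_distrib_right mult.assoc)
  qed
  have "B f (u i) = e i" if "i < n" for i
    unfolding fe by (rule coeffu[OF that])
  then have "(\<lambda>x. \<Sum>i<n. B f (u i) * u i x) = (\<lambda>x. \<Sum>i<n. e i * u i x)"
    by (intro ext sum.cong) auto
  then show ?thesis using fe by simp
qed

section \<open>The Dirichlet kernel as a reproducing kernel\<close>

lemma continuous_on_compact_measurable_bounded:
  fixes f :: "'a :: topological_space \<Rightarrow> real"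
  assumes "compact \<Omega>" "sets \<mu> = sets (restrict_space borel \<Omega>)" "continuous_on \<Omega> f"
  shows "f \<in> borel_measurable \<mu>" and "\<exists>C\<ge>0. \<forall>x\<in>\<Omega>. \<bar>f x\<bar> \<le> C"
proof -
  have "f \<in> borel_measurable (restrict_space borel \<Omega>)"
    by (rule borel_measurable_continuous_on_restrict[OF assms(3)])
  then show "f \<in> borel_measurable \<mu>"
    using measurable_cong_sets[OF assms(2) refl] by blast
  have "bounded (f ` \<Omega>)"
    by (rule compact_imp_bounded[OF compact_continuous_image[OF assms(3,1)]])
  then obtain C where "\<forall>x\<in>\<Omega>. \<bar>f x\<bar> \<le> C" by (auto simp: bounded_iff)
  then show "\<exists>C\<ge>0. \<forall>x\<in>\<Omega>. \<bar>f x\<bar> \<le> C"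
    by (intro exI[of _ "max C 0"]) (auto simp: max_def)
qed

lemma integrable_mult_continuous:
  fixes f :: "'a :: topological_space \<Rightarrow> real"
  assumes "compact \<Omega>" "space \<mu> = \<Omega>" "sets \<mu> = sets (restrict_space borel \<Omega>)"
    and "continuous_on \<Omega> f" "integrable \<mu> g"
  shows "integrable \<mu> (\<lambda>x. g x * f x)"
proof -
  obtain C where C: "0 \<le> C" "\<forall>x\<in>\<Omega>. \<bar>f x\<bar> \<le> C"
    using continuous_on_compact_measurable_bounded(2)[OF assms(1,3,4)] by blast
  have [measurable]: "f \<in> borel_measurable \<mu>" "g \<in> borel_measurable \<mu>"
    using continuous_on_compact_measurable_bounded(1)[OF assms(1,3,4)] assms(5) by auto
  show ?thesis
  proof (rule Bochner_Integration.integrable_bound)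
    show "integrable \<mu> (\<lambda>x. C * g x)" using assms(5) by simp
    show "AE x in \<mu>. norm (g x * f x) \<le> norm (C * g x)"
    proof (rule AE_I2)
      fix x assume "x \<in> space \<mu>"
      then have "\<bar>g x\<bar> * \<bar>f x\<bar> \<le> \<bar>g x\<bar> * C" using C assms(2) by (intro mult_left_mono) auto
      then show "norm (g x * f x) \<le> norm (C * g x)" using C by (simp add: abs_mult mult.commute)
    qed
  qed measurable
qed

text \<open>The kernel is built from an unspecified choice of orthonormal family. Gram-Schmidt shows
  that such a family exists, and completeness makes whichever one is chosen reproduce
  \<open>X\<close>.\<close>

lemma dirichlet_kernel_reproducing:
  fixes \<mu> :: "'a :: topological_space measure"
  assumes \<Omega>: "compact \<Omega>" "prob_space \<mu>" "space \<mu> = \<Omega>" "sets \<mu> = sets (restrict_space borel \<Omega>)"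
    and X: "cont_subspace_dim \<mu> \<Omega> N X"
  shows "\<exists>u. (\<forall>i<N. u i \<in> X) \<and> dirichlet_kernel \<mu> N X = (\<lambda>x y. \<Sum>j<N. u j x * u j y)
    \<and> (\<forall>f\<in>X. (\<forall>x. f x = (\<Sum>i<N. (LINT y|\<mu>. f y * u i y) * u i x)) \<and> continuous_on \<Omega> f)"
proof -
  interpret prob_space \<mu> by fact
  obtain z where Xz: "X = fspan N z" and z: "\<And>i. i < N \<Longrightarrow> continuous_on \<Omega> (z i)"
    and indep: "\<And>c i. (AE x in \<mu>. (\<Sum>i<N. c i * z i x) = 0) \<Longrightarrow> i < N \<Longrightarrow> c i = 0"
    using X unfolding cont_subspace_dim_def by blast
  have cont: "continuous_on \<Omega> f" if "f \<in> X" for f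
    using that z unfolding Xz fspan_def by (auto intro!: continuous_intros)
  have int: "integrable \<mu> (\<lambda>x. f x * g x)" if "f \<in> X" "g \<in> X" for f g
  proof -
    have "integrable \<mu> (\<lambda>x. 1 * f x)"
      by (rule integrable_mult_continuous[OF \<Omega>(1,3,4) cont[OF that(1)]]) simp
    then show ?thesis
      using integrable_mult_continuous[OF \<Omega>(1,3,4) cont[OF that(2)]] by simp
  qed
  define B where "B f g = (LINT x|\<mu>. f x * g x)" for f g :: "'a \<Rightarrow> real"
  interpret semi_inner_product X B
  proof unfold_locales
    show "B (\<lambda>x. f x + g x) h = B f h + B g h" if "f \<in> X" "g \<in> X" "h \<in> X" for f g h
      unfolding B_def using int that by (simp add: distrib_right)
    show "B (\<lambda>x. c * f x) h = c * B f h" for f h c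
      unfolding B_def by (simp add: mult.assoc)
    show "0 \<le> B f f" for f
      unfolding B_def by (intro integral_nonneg_AE) auto
  qed (use Xz in \<open>auto simp: B_def mult.commute intro: fspan_zero fspan_add fspan_cmult\<close>)
  have null: "AE x in \<mu>. f x = 0" if "f \<in> X" "B f f = 0" for f
    using that(2) int[OF that(1,1)] unfolding B_def
    by (subst (asm) integral_nonneg_eq_0_iff_AE) auto
  \<comment> \<open>Independence holds modulo null sets: a combination vanishing almost everywhere
    has zero coefficients, hence vanishes at every point. Thus the reproducing formula holds
    pointwise.\<close>
  have definite: "f = (\<lambda>x. 0)" if f: "f \<in> X" "B f f = 0" for f
  proof -
    obtain c where c: "f = (\<lambda>x. \<Sum>i<N. c i * z i x)" using f(1) unfolding Xz fspan_def by blast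
    have "c i = 0" if "i < N" for i
      using indep[OF _ that, of c] null[OF f] unfolding c .
    then show ?thesis unfolding c by simp
  qed
  have "nondegenerate N z"
    unfolding nondegenerate_def using null indep fspanI[of _ z N] unfolding Xz[symmetric] by blast
  then obtain \<phi> where \<phi>: "spans_orthonormally N z N \<phi>"
    using gram_schmidt[of N z] fspan_base[of _ N z] unfolding Xz[symmetric] by blast
  have "is_onb \<mu> N X \<phi>"
    using spans_orthonormallyD[OF \<phi>] int unfolding is_onb_def B_def by blast
  then have onb: "is_onb \<mu> N X (SOME u. is_onb \<mu> N X u)" by (rule someI[where P = "is_onb \<mu> N X"])
  define u where "u = (SOME u. is_onb \<mu> N X u)"
  have uX: "u i \<in> X" if "i < N" for i
    using onb that unfolding is_onb_def u_def by blast
  have uo: "B (u i) (u j) = (if i = j then 1 else 0)" if "i < N" "j < N" for i j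
    using onb that unfolding is_onb_def u_def B_def by blast
  have "dirichlet_kernel \<mu> N X = (\<lambda>x y. \<Sum>j<N. u j x * u j y)"
    unfolding dirichlet_kernel_def u_def Let_def by (rule refl)
  moreover have "f x = (\<Sum>i<N. (LINT y|\<mu>. f y * u i y) * u i x)" if f: "f \<in> X" for f x
    using fun_cong[OF orthonormal_family_complete[of N z \<phi> u f, OF definite Xz \<phi> uX uo f], of x]
    unfolding B_def by blast
  ultimately show ?thesis using uX cont by blast
qed

text \<open>Reproducing the constant 1 gives the lower bound on the error. In the sampling
  inequality the constant 9 is the quotient of the two discretization constants 9/4 and 1/4.\<close>

lemma sampling_of_error_kernel:
  fixes \<mu> :: "'a :: topological_space measure"
  assumes \<Omega>: "compact \<Omega>" "prob_space \<mu>" "space \<mu> = \<Omega>" "sets \<mu> = sets (restrict_space borel \<Omega>)"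
    and X: "cont_subspace_dim \<mu> \<Omega> N X" and one: "(\<lambda>x. 1) \<in> X"
    and W: "W \<in> B_perp \<mu> \<Omega> X M"
    and m: "0 < m" "1024 * real ((M + N) * N) * (ln (4 * real ((M + N) * N)) + 2) \<le> real m"
  defines "e \<equiv> \<lambda>x. LINT y|\<mu>. \<bar>dirichlet_kernel \<mu> N X x y - W x y\<bar>"
  shows "1 \<le> Sup (e ` \<Omega>)"
    and "\<exists>\<xi>. (\<forall>k<m. \<xi> k \<in> \<Omega>) \<and>
      (\<forall>f\<in>X. Sup ((\<lambda>x. \<bar>f x\<bar>) ` \<Omega>) \<le> 9 * Sup (e ` \<Omega>) * Max ((\<lambda>k. \<bar>f (\<xi> k)\<bar>) ` {..<m}))"
proof -
  interpret prob_space \<mu> by fact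
  have ne: "\<Omega> \<noteq> {}" using not_empty \<Omega>(3) by simp
  obtain u where uX: "\<And>i. i < N \<Longrightarrow> u i \<in> X"
    and D: "dirichlet_kernel \<mu> N X = (\<lambda>x y. \<Sum>j<N. u j x * u j y)"
    and rep: "\<And>f x. f \<in> X \<Longrightarrow> f x = (\<Sum>i<N. (LINT y|\<mu>. f y * u i y) * u i x)"
    and cont: "\<And>f. f \<in> X \<Longrightarrow> continuous_on \<Omega> f"
    using dirichlet_kernel_reproducing[OF \<Omega> X] by blast
  obtain w v where w: "\<And>i. i < M \<Longrightarrow> continuous_on \<Omega> (w i)" and v: "\<And>i. i < M \<Longrightarrow> integrable \<mu> (v i)"
    and Wwv: "\<And>x y. W x y = (\<Sum>i<M. w i x * v i y)"
    and perp: "\<And>f x. f \<in> X \<Longrightarrow> x \<in> \<Omega> \<Longrightarrow> (LINT y|\<mu>. W x y * f y) = 0"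
    using W unfolding B_perp_def by blast
  note int_mult = integrable_mult_continuous[OF \<Omega>(1,3,4)]
  have X_int: "integrable \<mu> f" if "f \<in> X" for f
    using int_mult[OF cont[OF that], of "\<lambda>x. 1"] by simp
  define g where "g x y = (\<Sum>j<N. u j x * u j y) - (\<Sum>i<M. w i x * v i y)" for x y
  have e: "e x = (LINT y|\<mu>. \<bar>g x y\<bar>)" for x
    unfolding e_def D Wwv g_def ..
  \<comment> \<open>\<open>q\<close> lists the \<open>u j\<close> first and then the
    \<open>v i\<close>. The index \<open>l = k * N + i\<close> of \<open>z\<close> encodes the pair
    of a factor \<open>q k\<close> and a factor \<open>u i\<close>, recovered by division with
    remainder.\<close>
  define q where "q k = (if k < N then u k else v (k - N))" for k
  define z where "z l y = q (l div N) y * u (l mod N) y" for l y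
  let ?n = "(M + N) * N"
  have N: "0 < N"
  proof (rule ccontr)
    assume "\<not> 0 < N"
    then show False using rep[OF one] by simp
  qed
  have q_int: "integrable \<mu> (q k)" if "k < M + N" for k
    using that v[of "k - N"] uX[of k] X_int by (auto simp: q_def)
  have z_int: "integrable \<mu> (z l)" if "l < ?n" for l
  proof -
    have "l div N < M + N" using that N by (simp add: less_mult_imp_div_less)
    then show ?thesis
      unfolding z_def using N by (intro int_mult cont uX q_int) auto
  qed
  have X_sub: "f \<in> fspan N u" if "f \<in> X" for f
  proof -
    define b where "b i = (LINT y|\<mu>. f y * u i y)" for i
    have eq: "f = (\<lambda>x. \<Sum>i<N. b i * u i x)" unfolding b_def by (rule ext) (rule rep[OF that])
    show ?thesis unfolding eq by (rule fspanI)
  qed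
  have u_q: "u j \<in> fspan (M + N) q" if "j < N" for j
    using fspan_base[of j "M + N" q] that by (simp add: q_def)
  have v_q: "v i \<in> fspan (M + N) q" if "i < M" for i
    using fspan_base[of "N + i" "M + N" q] that by (simp add: q_def)
  have X_q: "f \<in> fspan (M + N) q" if f: "f \<in> X" for f
  proof -
    obtain b where "f = (\<lambda>x. \<Sum>i<N. b i * u i x)" using X_sub[OF f] unfolding fspan_def by blast
    then show ?thesis using u_q by (auto intro!: fspan_sum_cmult)
  qed
  have g_q: "g x \<in> fspan (M + N) q" for x
  proof -
    have "(\<lambda>y. (\<Sum>j<N. u j x * u j y) + (\<Sum>i<M. (- w i x) * v i y)) \<in> fspan (M + N) q"
      by (intro fspan_add fspan_sum_cmult u_q v_q) auto
    also have "(\<lambda>y. (\<Sum>j<N. u j x * u j y) + (\<Sum>i<M. (- w i x) * v i y)) = g x"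
      by (auto simp: g_def sum_negf)
    finally show ?thesis .
  qed
  have product: "(\<lambda>y. h y * f y) \<in> fspan ?n z" if h: "h \<in> fspan (M + N) q" and f: "f \<in> X" for h f
  proof -
    obtain a where a: "h = (\<lambda>y. \<Sum>k<M + N. a k * q k y)" using h unfolding fspan_def by blast
    obtain b where b: "f = (\<lambda>y. \<Sum>i<N. b i * u i y)" using X_sub[OF f] unfolding fspan_def by blast
    have base: "(\<lambda>y. q k y * u i y) \<in> fspan ?n z" if "k < M + N" "i < N" for k i
    proof -
      have "k * N + i < Suc k * N" using that by simp
      also have "\<dots> \<le> ?n" using that by (intro mult_right_mono) auto
      finally have "z (k * N + i) \<in> fspan ?n z" by (rule fspan_base)
      moreover have "z (k * N + i) = (\<lambda>y. q k y * u i y)"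
        using that by (auto simp: z_def)
      ultimately show ?thesis by simp
    qed
    have "(\<lambda>y. h y * f y) = (\<lambda>y. \<Sum>k<M + N. a k * (\<Sum>i<N. b i * (q k y * u i y)))"
      unfolding a b by (simp add: sum_product sum_distrib_left ac_simps)
    also have "\<dots> \<in> fspan ?n z"
      by (rule fspan_sum_cmult, rule fspan_sum_cmult, rule base) auto
    finally show ?thesis .
  qed
  \<comment> \<open>Multiplying by the constant 1 in \<open>X\<close> puts the error kernel itself
    into the product space, so the upper discretization estimate applies to it.\<close>
  have g_z: "g x \<in> fspan ?n z" for x using product[OF g_q one] by simp
  have fspan_int: "integrable \<mu> h" if "h \<in> fspan ?n z" for h
    using that z_int unfolding fspan_def by auto
  have reproduce: "f x = (LINT y|\<mu>. g x y * f y)" if f: "f \<in> X" and x: "x \<in> \<Omega>" for f x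
  proof -
    have uf: "integrable \<mu> (\<lambda>y. u j y * f y)" if "j < N" for j
      using int_mult[OF cont[OF f] X_int[OF uX[OF that]]] .
    have vf: "integrable \<mu> (\<lambda>y. v i y * f y)" if "i < M" for i
      using int_mult[OF cont[OF f] v[OF that]] .
    have "(LINT y|\<mu>. g x y * f y)
      = (LINT y|\<mu>. (\<Sum>j<N. u j x * (u j y * f y)) - W x y * f y)"
      by (simp add: g_def Wwv left_diff_distrib sum_distrib_right mult.assoc)
    also have "\<dots> = (LINT y|\<mu>. (\<Sum>j<N. u j x * (u j y * f y))) - (LINT y|\<mu>. W x y * f y)"
    proof (rule Bochner_Integration.integral_diff)
      show "integrable \<mu> (\<lambda>y. W x y * f y)"
        unfolding Wwv sum_distrib_right mult.assoc
        using vf by (intro Bochner_Integration.integrable_sum integrable_mult_right) auto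
    qed (use uf in auto)
    also have "\<dots> = (\<Sum>j<N. u j x * (LINT y|\<mu>. u j y * f y))"
      using uf perp[OF f x] by simp
    also have "\<dots> = f x"
      by (subst rep[OF f]) (simp add: mult.commute)
    finally show ?thesis by simp
  qed
  \<comment> \<open>Compactness bounds the \<open>u j\<close> and \<open>w i\<close> in
    \<open>x\<close>, which keeps the errors bounded above and makes their real supremum a genuine
    upper bound.\<close>
  have e_le: "e x \<le> Sup (e ` \<Omega>)" if x: "x \<in> \<Omega>" for x
  proof (rule cSUP_upper[OF x])
    have "\<forall>j<N. \<exists>C\<ge>0. \<forall>x\<in>\<Omega>. \<bar>u j x\<bar> \<le> C"
      using continuous_on_compact_measurable_bounded(2)[OF \<Omega>(1,4)] cont uX by blast
    then obtain cu where cu: "\<And>j x. j < N \<Longrightarrow> x \<in> \<Omega> \<Longrightarrow> \<bar>u j x\<bar> \<le> cu j" by metis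
    have "\<forall>i<M. \<exists>C\<ge>0. \<forall>x\<in>\<Omega>. \<bar>w i x\<bar> \<le> C"
      using continuous_on_compact_measurable_bounded(2)[OF \<Omega>(1,4)] w by blast
    then obtain cw where cw: "\<And>i x. i < M \<Longrightarrow> x \<in> \<Omega> \<Longrightarrow> \<bar>w i x\<bar> \<le> cw i" by metis
    let ?b = "\<lambda>y. (\<Sum>j<N. cu j * \<bar>u j y\<bar>) + (\<Sum>i<M. cw i * \<bar>v i y\<bar>)"
    have b_int: "integrable \<mu> ?b"
      using uX X_int v by (intro Bochner_Integration.integrable_add Bochner_Integration.integrable_sum
          integrable_mult_right integrable_abs) auto
    show "bdd_above (e ` \<Omega>)"
    proof (rule bdd_aboveI2)
      fix x assume x: "x \<in> \<Omega>"
      show "e x \<le> (LINT y|\<mu>. ?b y)"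
        unfolding e
      proof (rule integral_mono[OF integrable_abs[OF fspan_int[OF g_z]] b_int])
        fix y
        have "\<bar>\<Sum>j<N. u j x * u j y\<bar> \<le> (\<Sum>j<N. cu j * \<bar>u j y\<bar>)"
          by (rule order_trans[OF sum_abs sum_mono]) (auto simp: abs_mult intro!: mult_right_mono cu x)
        moreover have "\<bar>\<Sum>i<M. w i x * v i y\<bar> \<le> (\<Sum>i<M. cw i * \<bar>v i y\<bar>)"
          by (rule order_trans[OF sum_abs sum_mono]) (auto simp: abs_mult intro!: mult_right_mono cw x)
        ultimately show "\<bar>g x y\<bar> \<le> ?b y" unfolding g_def by linarith
      qed
    qed
  qed
  show "1 \<le> Sup (e ` \<Omega>)"
  proof -
    obtain x where x: "x \<in> \<Omega>" using ne by blast
    have "1 = \<bar>LINT y|\<mu>. g x y\<bar>" using reproduce[OF one x] by simp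
    also have "\<dots> \<le> e x" unfolding e by (rule integral_abs_bound)
    also have "\<dots> \<le> Sup (e ` \<Omega>)" by (rule e_le[OF x])
    finally show ?thesis .
  qed
  have "(\<lambda>x. 1) \<in> fspan ?n z" using product[OF X_q[OF one] one] by simp
  moreover have "0 < (LINT x|\<mu>. \<bar>1 :: real\<bar>)" by (simp add: prob_space)
  ultimately obtain \<xi> c where \<xi>: "\<And>k. k < m \<Longrightarrow> \<xi> k \<in> space \<mu> \<and> 0 \<le> c k"
    and low: "\<And>h. h \<in> fspan ?n z \<Longrightarrow> (LINT x|\<mu>. \<bar>h x\<bar>) / 4 \<le> (\<Sum>k<m. c k * \<bar>h (\<xi> k)\<bar>)"
    and up: "\<And>h. h \<in> fspan ?n z \<Longrightarrow> (\<Sum>k<m. c k * \<bar>h (\<xi> k)\<bar>) \<le> 9 / 4 * (LINT x|\<mu>. \<bar>h x\<bar>)"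
    using L1_sampling_discretization[of ?n \<mu> z "\<lambda>x. 1" m, OF z_int _ _ m(2)] by blast
  have "Sup ((\<lambda>x. \<bar>f x\<bar>) ` \<Omega>) \<le> 9 * Sup (e ` \<Omega>) * Max ((\<lambda>k. \<bar>f (\<xi> k)\<bar>) ` {..<m})"
    if f: "f \<in> X" for f
  proof (rule cSUP_least[OF ne])
    fix x assume x: "x \<in> \<Omega>"
    let ?F = "Max ((\<lambda>k. \<bar>f (\<xi> k)\<bar>) ` {..<m})"
    have F: "\<bar>f (\<xi> k)\<bar> \<le> ?F" if "k < m" for k using that by (intro Max_ge) auto
    have F0: "0 \<le> ?F" using F[OF m(1)] by linarith
    have gf: "(\<lambda>y. g x y * f y) \<in> fspan ?n z" by (rule product[OF g_q f])
    have "\<bar>f x\<bar> \<le> (LINT y|\<mu>. \<bar>g x y * f y\<bar>)"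
      unfolding reproduce[OF f x] by (rule integral_abs_bound)
    also have "\<dots> \<le> 4 * (\<Sum>k<m. c k * \<bar>g x (\<xi> k) * f (\<xi> k)\<bar>)"
      using low[OF gf] by simp
    also have "\<dots> \<le> 4 * (\<Sum>k<m. c k * \<bar>g x (\<xi> k)\<bar> * ?F)"
      using F \<xi> by (intro mult_left_mono sum_mono) (auto simp: abs_mult mult.assoc intro!: mult_left_mono)
    also have "\<dots> = 4 * ?F * (\<Sum>k<m. c k * \<bar>g x (\<xi> k)\<bar>)"
      by (simp add: mult.commute flip: sum_distrib_right)
    also have "\<dots> \<le> 4 * ?F * (9 / 4 * e x)"
      using up[OF g_z] F0 unfolding e by (intro mult_left_mono) auto
    also have "\<dots> \<le> 4 * ?F * (9 / 4 * Sup (e ` \<Omega>))"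
      using e_le[OF x] F0 by (intro mult_left_mono) auto
    finally show "\<bar>f x\<bar> \<le> 9 * Sup (e ` \<Omega>) * ?F" by (simp add: ac_simps)
  qed
  then show "\<exists>\<xi>. (\<forall>k<m. \<xi> k \<in> \<Omega>) \<and>
      (\<forall>f\<in>X. Sup ((\<lambda>x. \<bar>f x\<bar>) ` \<Omega>) \<le> 9 * Sup (e ` \<Omega>) * Max ((\<lambda>k. \<bar>f (\<xi> k)\<bar>) ` {..<m}))"
    using \<xi> \<Omega>(3) by blast
qed

text \<open>The maximum with 2 matters for \<open>n = 1\<close>, where the logarithm is zero. Since
  \<open>1 \<le> 2 * l\<close>, the additive constants \<open>ln 4 + 2 \<le> 5\<close> cost at most
  \<open>10 * l\<close> and the rounding up at most \<open>2 * n * l\<close>; 1024 * 11 + 2 is below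
  12000.\<close>

lemma sample_count_exists:
  assumes "1 \<le> n"
  shows "\<exists>m. 0 < m \<and> 1024 * real n * (ln (4 * real n) + 2) \<le> real m
    \<and> real m \<le> 12000 * real n * ln (max 2 (real n))"
proof -
  define l where "l = ln (max 2 (real n))"
  define a where "a = 1024 * real n * (ln (4 * real n) + 2)"
  have n: "1 \<le> real n" using assms by simp
  have "ln 2 \<le> l" unfolding l_def by simp
  then have l: "1 \<le> 2 * l" using ln2_ge_two_thirds by linarith
  have "ln (real n) \<le> l" using n unfolding l_def by simp
  moreover have "ln (4 * real n) = ln 4 + ln (real n)" using n by (simp add: ln_mult)
  moreover have "ln (4 :: real) \<le> 3" using ln_le_minus_one[of 4] by simp
  ultimately have "ln (4 * real n) + 2 \<le> 11 * l" using l by linarith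
  then have "a \<le> 1024 * real n * (11 * l)"
    unfolding a_def using n by (intro mult_left_mono) auto
  moreover have "1 \<le> 2 * (real n * l)"
    using mult_mono[OF n l] n by simp
  ultimately have upper: "a + 1 \<le> 12000 * (real n * l)" by simp
  have "0 < a" unfolding a_def using n by (intro mult_pos_pos add_nonneg_pos ln_ge_zero) auto
  define m where "m = nat \<lceil>a\<rceil>"
  have "a \<le> real m" "real m \<le> a + 1" "0 < m"
    using \<open>0 < a\<close> unfolding m_def by linarith+
  then show ?thesis
    using upper unfolding a_def l_def by (intro exI[of _ m]) auto
qed

theorem theorem3p3:
  "\<exists>C1 C2 :: real. C1 > 0 \<and> C2 > 0 \<and>
    (\<forall>(d::nat) (\<Omega>::(nat \<Rightarrow> real) set) (\<mu>::(nat \<Rightarrow> real) measure) (N::nat) (X::((nat \<Rightarrow> real) \<Rightarrow> real) set) (M::nat).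
       \<Omega> \<subseteq> euclid_pts d \<and> compact \<Omega> \<and>
       prob_space \<mu> \<and> space \<mu> = \<Omega> \<and> sets \<mu> = sets (restrict_space borel \<Omega>) \<and>
       cont_subspace_dim \<mu> \<Omega> N X \<and> (\<lambda>x. 1) \<in> X
       \<longrightarrow>
       (\<exists>(m::nat) (\<xi>::nat \<Rightarrow> nat \<Rightarrow> real). 0 < m \<and> (\<forall>\<nu><m. \<xi> \<nu> \<in> \<Omega>) \<and>
          real m \<le> C1 * real ((M + N) * N) * ln (max 2 (real ((M + N) * N))) \<and>
          (\<forall>f\<in>X. Sup ((\<lambda>x. \<bar>f x\<bar>) ` \<Omega>) \<le>
             C2 * sigma_c \<mu> \<Omega> X M (dirichlet_kernel \<mu> N X) *
               Max ((\<lambda>\<nu>. \<bar>f (\<xi> \<nu>)\<bar>) ` {..<m}))))"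
proof (rule exI[of _ 12000], rule exI[of _ 18], intro conjI allI impI, goal_cases)
  case (3 d \<Omega> \<mu> N X M)
  then have \<Omega>: "compact \<Omega>" "prob_space \<mu>" "space \<mu> = \<Omega>" "sets \<mu> = sets (restrict_space borel \<Omega>)"
    and X: "cont_subspace_dim \<mu> \<Omega> N X" and one: "(\<lambda>x. 1) \<in> X" by auto
  have "N \<noteq> 0"
  proof
    assume "N = 0"
    then have "X = {\<lambda>x. 0}" using X by (auto simp: cont_subspace_dim_def fspan_def)
    with one show False by (auto dest: fun_cong)
  qed
  then have "1 \<le> (M + N) * N" by simp
  from sample_count_exists[OF this] obtain m where
    m: "0 < m" "1024 * real ((M + N) * N) * (ln (4 * real ((M + N) * N)) + 2) \<le> real m"
    "real m \<le> 12000 * real ((M + N) * N) * ln (max 2 (real ((M + N) * N)))" by blast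
  define err where "err W = Sup ((\<lambda>x. LINT y|\<mu>. \<bar>dirichlet_kernel \<mu> N X x y - W x y\<bar>) ` \<Omega>)" for W
  define \<sigma> where "\<sigma> = sigma_c \<mu> \<Omega> X M (dirichlet_kernel \<mu> N X)"
  have \<sigma>_eq: "\<sigma> = Inf {err W | W. W \<in> B_perp \<mu> \<Omega> X M}"
    unfolding \<sigma>_def sigma_c_def err_def ..
  note sampling = sampling_of_error_kernel[OF \<Omega> X one _ m(1,2), folded err_def]
  have "(\<lambda>x y. 0) \<in> B_perp \<mu> \<Omega> X M"
    unfolding B_perp_def by (auto intro!: exI[of _ "\<lambda>i x. 0"])
  then have ne: "{err W | W. W \<in> B_perp \<mu> \<Omega> X M} \<noteq> {}" by blast
  have "1 \<le> \<sigma>" unfolding \<sigma>_eq by (rule cInf_greatest[OF ne]) (use sampling(1) in auto)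
  \<comment> \<open>The infimum need not be attained. As it is at least 1, its double lies strictly
    above it, and some admissible \<open>W\<close> has error below that.\<close>
  then have "Inf {err W | W. W \<in> B_perp \<mu> \<Omega> X M} < 2 * \<sigma>" unfolding \<sigma>_eq by simp
  from cInf_lessD[OF ne this] obtain W where W: "W \<in> B_perp \<mu> \<Omega> X M" "err W < 2 * \<sigma>" by blast
  from sampling(2)[OF W(1)] obtain \<xi> where \<xi>: "\<forall>k<m. \<xi> k \<in> \<Omega>"
    and bound: "\<And>f. f \<in> X \<Longrightarrow> Sup ((\<lambda>x. \<bar>f x\<bar>) ` \<Omega>) \<le> 9 * err W * Max ((\<lambda>k. \<bar>f (\<xi> k)\<bar>) ` {..<m})"
    by blast
  have "Sup ((\<lambda>x. \<bar>f x\<bar>) ` \<Omega>) \<le> 18 * \<sigma> * Max ((\<lambda>k. \<bar>f (\<xi> k)\<bar>) ` {..<m})" if f: "f \<in> X" for f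
  proof -
    \<comment> \<open>As \<open>m\<close> is positive the maximum runs over a nonempty set and is
      nonnegative, so the error of \<open>W\<close> may be replaced by \<open>2 * \<sigma>\<close>;
      this turns 9 into 18.\<close>
    have "\<bar>f (\<xi> 0)\<bar> \<le> Max ((\<lambda>k. \<bar>f (\<xi> k)\<bar>) ` {..<m})" using m(1) by (intro Max_ge) auto
    then have "9 * err W * Max ((\<lambda>k. \<bar>f (\<xi> k)\<bar>) ` {..<m}) \<le> 18 * \<sigma> * Max ((\<lambda>k. \<bar>f (\<xi> k)\<bar>) ` {..<m})"
      using W(2) by (intro mult_right_mono) auto
    with bound[OF f] show ?thesis by linarith
  qed
  then show ?case using m \<xi> unfolding \<sigma>_def by blast
qed simp_all

end
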